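(* Let $m\ge2$ and let $\lambda_m$ be an $m$-core. Then \[ \sum_{\mu\in \mathcal{P}_{\lambda_m}\cap \mathcal{R}_m}q^{|\mu|}=\frac{q^{|\lambda_m|}}{\prod_{i\geq 1}(1-q^{mi})^{m-1}} \qquad\text{and}\qquad \sum_{\mu\in\mathcal{P}_{\lambda_m}}t^{h_{m,0}(\mu)}q^{|\mu|}=\frac{q^{|\lambda_m|}}{\prod_{i\geq 1}(1-q^{mi})^{m-1}(1-tq^{mi})}. \]
   Context: An $m$-core is a partition with no hook length equal to $m$. The $m$-core of a partition $\mu$ is obtained by repeatedly removing rim hooks of length $m$ (leaving a Young diagram each time) until impossible; it is well defined. $\mathcal{P}_{\lambda_m}$ is the set of partitions whose $m$-core is $\lambda_m$. $\mathcal{R}_m$ is the set of $m$-restricted partitions, i.e. partitions $\mu$ with $\mu_i-\mu_{i+1}<m$ for all $i\ge1$ (equivalently, no part of the conjugate partition occurs $m$ or more times). For a cell $v$, $a_v$ is its arm length and $l_v$ its leg length; $h_{m,0}(\mu)$ is the number of cells $v$ of $\mu$ with $l_v=0$ and $m\mid a_v+1$. *)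

theory Defs
  imports "HOL-Analysis.Analysis" "HOL-Computational_Algebra.Formal_Power_Series"
begin

text \<open>
  A partition is an infinite weakly decreasing sequence with finitely many nonzero terms.
  Rows, columns and parts are indexed from 0, so the part usually written \<open>\<mu>\<^sub>i\<close> is \<open>\<mu> (i - 1)\<close>.
\<close>

definition is_partition :: "(nat \<Rightarrow> nat) \<Rightarrow> bool" where
  "is_partition \<mu> \<longleftrightarrow> antimono \<mu> \<and> finite {i. \<mu> i \<noteq> 0}"

definition psize :: "(nat \<Rightarrow> nat) \<Rightarrow> nat" where
  "psize \<mu> = (\<Sum>i | \<mu> i \<noteq> 0. \<mu> i)"

definition diagram :: "(nat \<Rightarrow> nat) \<Rightarrow> (nat \<times> nat) set" where
  "diagram \<mu> = {(i, j). j < \<mu> i}"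

definition arm :: "(nat \<Rightarrow> nat) \<Rightarrow> nat \<times> nat \<Rightarrow> nat" where
  "arm \<mu> v = card {j. snd v < j \<and> (fst v, j) \<in> diagram \<mu>}"

definition leg :: "(nat \<Rightarrow> nat) \<Rightarrow> nat \<times> nat \<Rightarrow> nat" where
  "leg \<mu> v = card {i. fst v < i \<and> (i, snd v) \<in> diagram \<mu>}"

definition hook_length :: "(nat \<Rightarrow> nat) \<Rightarrow> nat \<times> nat \<Rightarrow> nat" where
  "hook_length \<mu> v = arm \<mu> v + leg \<mu> v + 1"

definition is_core :: "nat \<Rightarrow> (nat \<Rightarrow> nat) \<Rightarrow> bool" where
  "is_core m \<mu> \<longleftrightarrow> is_partition \<mu> \<and> (\<forall>v \<in> diagram \<mu>. hook_length \<mu> v \<noteq> m)"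

definition adjacent :: "nat \<times> nat \<Rightarrow> nat \<times> nat \<Rightarrow> bool" where
  "adjacent v w \<longleftrightarrow>
     fst v = fst w \<and> (snd v = Suc (snd w) \<or> snd w = Suc (snd v)) \<or>
     snd v = snd w \<and> (fst v = Suc (fst w) \<or> fst w = Suc (fst v))"

definition edge_connected :: "(nat \<times> nat) set \<Rightarrow> bool" where
  "edge_connected S \<longleftrightarrow>
     (\<forall>v \<in> S. \<forall>w \<in> S. (\<lambda>x y. x \<in> S \<and> y \<in> S \<and> adjacent x y)\<^sup>*\<^sup>* v w)"

text \<open>
  A rim hook is an edge-connected skew shape that contains no two-by-two square.
\<close>

definition removes_rim_hook :: "nat \<Rightarrow> (nat \<Rightarrow> nat) \<Rightarrow> (nat \<Rightarrow> nat) \<Rightarrow> bool" where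
  "removes_rim_hook m \<mu> \<nu> \<longleftrightarrow>
     is_partition \<mu> \<and> is_partition \<nu> \<and> diagram \<nu> \<subseteq> diagram \<mu> \<and>
     (let S = diagram \<mu> - diagram \<nu> in
        card S = m \<and> edge_connected S \<and>
        (\<nexists>i j. {(i, j), (Suc i, j), (i, Suc j), (Suc i, Suc j)} \<subseteq> S))"

text \<open>
  The \<open>m\<close>-core is given as a relation between \<open>\<mu>\<close> and the outcome of a maximal sequence of
  removals, so that the definition does not presuppose uniqueness of that outcome.
\<close>

definition has_core :: "nat \<Rightarrow> (nat \<Rightarrow> nat) \<Rightarrow> (nat \<Rightarrow> nat) \<Rightarrow> bool" where
  "has_core m \<mu> \<nu> \<longleftrightarrow>
     (removes_rim_hook m)\<^sup>*\<^sup>* \<mu> \<nu> \<and> (\<nexists>\<kappa>. removes_rim_hook m \<nu> \<kappa>)"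

definition partitions_with_core :: "nat \<Rightarrow> (nat \<Rightarrow> nat) \<Rightarrow> (nat \<Rightarrow> nat) set" where
  "partitions_with_core m core = {\<mu>. is_partition \<mu> \<and> has_core m \<mu> core}"

definition restricted_partitions :: "nat \<Rightarrow> (nat \<Rightarrow> nat) set" where
  "restricted_partitions m = {\<mu>. is_partition \<mu> \<and> (\<forall>i. \<mu> i - \<mu> (Suc i) < m)}"

definition h0 :: "nat \<Rightarrow> (nat \<Rightarrow> nat) \<Rightarrow> nat" where
  "h0 m \<mu> = card {v \<in> diagram \<mu>. leg \<mu> v = 0 \<and> m dvd arm \<mu> v + 1}"

text \<open>
  The generating functions are formal power series in \<open>q\<close>, with coefficients in the power series
  ring in \<open>t\<close> over the rationals where \<open>t\<close> occurs. Infinite sums and products of them converge in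
  the \<open>q\<close>-adic metric that the library puts on \<^typ>\<open>'a fps\<close>.
\<close>

abbreviation qvar :: "'a :: comm_ring_1 fps" where
  "qvar \<equiv> fps_X"

abbreviation tvar :: "rat fps fps" where
  "tvar \<equiv> fps_const fps_X"

end

(*
  Reading a partition \<open>\<mu>\<close> as the set of beads \<open>\<mu>\<^sub>i - i - 1\<close>, the removal of a rim hook of length \<open>m\<close>
  moves a bead from \<open>x\<close> to an empty position \<open>x - m\<close>. Splitting the beads by residue modulo \<open>m\<close> gives
  \<open>m\<close> independent runners; their charges are invariant and determine the core, while their shapes are
  arbitrary partitions (the \<open>m\<close>-quotient) whose sizes are lowered by one in each removal. Hence, with
  \<open>G t = (\<Sum>\<rho>. t ^ \<rho>\<^sub>0 * q ^ (m * \<bar>\<rho>\<bar>))\<close>, the partitions with core \<open>\<kappa>\<close> have generating function \<open>q ^ \<bar>\<kappa>\<bar> * G 1 ^ m\<close>.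

  On the other hand, every partition is uniquely \<open>\<nu> + m * \<rho>\<close> with \<open>\<nu>\<close> restricted. This has the same core as
  \<open>\<nu>\<close>, since \<open>m * \<rho>\<close> can be taken away in horizontal strips of length \<open>m\<close>, and its statistic \<open>h0\<close> is the
  largest part of \<open>\<rho>\<close>. So the two sums of the theorem are \<open>R\<close> and \<open>R * G t\<close>, where \<open>R * G 1 = q ^ \<bar>\<kappa>\<bar> * G 1 ^ m\<close>.
  Finally \<open>G t\<close> is the inverse of the product of all \<open>1 - t * q ^ (m * i)\<close>.
*)

theory Submission
  imports Defs
begin

unbundle no vec_syntax
unbundle fps_syntax

section \<open>Generating functions of graded sets\<close>

text \<open>The weight \<open>w\<close> is the exponent of q and \<open>g\<close> the coefficient,
  which may itself be a power series in t. Over an infinite fibre of \<open>w\<close> the sum would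
  take its default value 0; \<open>graded\<close> excludes this.\<close>

definition gf :: "'b set \<Rightarrow> ('b \<Rightarrow> nat) \<Rightarrow> ('b \<Rightarrow> 'a::comm_ring_1) \<Rightarrow> 'a fps" where
  "gf A w g = Abs_fps (\<lambda>n. \<Sum>a | a \<in> A \<and> w a = n. g a)"

definition graded :: "'b set \<Rightarrow> ('b \<Rightarrow> nat) \<Rightarrow> bool" where
  "graded A w \<longleftrightarrow> (\<forall>n. finite {a \<in> A. w a = n})"

lemma gf_nth: "gf A w g $ n = (\<Sum>a | a \<in> A \<and> w a = n. g a)"
  by (simp add: gf_def)

lemma gradedD: "graded A w \<Longrightarrow> finite {a \<in> A. w a = n}"
  by (simp add: graded_def)

lemma graded_subset: "graded B w \<Longrightarrow> A \<subseteq> B \<Longrightarrow> graded A w"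
  unfolding graded_def by (auto intro: rev_finite_subset)

text \<open>Links the coefficientwise definition with q-adic summation: each coefficient receives
  only finitely many nonzero contributions, and this suffices for \<open>has_sum\<close>.\<close>

lemma has_sum_gf:
  assumes "graded A w"
  shows "((\<lambda>a. fps_const (g a) * fps_X ^ w a) has_sum gf A w g) A"
proof (rule has_sum_fpsI)
  fix n
  have nth: "(fps_const (g a) * fps_X ^ w a) $ n = (if w a = n then g a else 0)" for a
    by (simp add: fps_X_power_nth)
  have sub: "{a \<in> A. (fps_const (g a) * fps_X ^ w a) $ n \<noteq> 0} \<subseteq> {a \<in> A. w a = n}"
    by (auto simp: nth split: if_splits)
  show "finite {a \<in> A. (fps_const (g a) * fps_X ^ w a) $ n \<noteq> 0}"
    using finite_subset[OF sub gradedD[OF assms]] .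
  have "gf A w g $ n = (\<Sum>a | a \<in> A \<and> w a = n. (fps_const (g a) * fps_X ^ w a) $ n)"
    unfolding gf_nth by (intro sum.cong) (auto simp: nth)
  also have "\<dots> = (\<Sum>a | a \<in> A \<and> (fps_const (g a) * fps_X ^ w a) $ n \<noteq> 0. (fps_const (g a) * fps_X ^ w a) $ n)"
    by (rule sum.mono_neutral_right[OF gradedD[OF assms] sub]) auto
  finally show "gf A w g $ n = \<dots>" .
qed

lemma gf_bij:
  assumes "bij_betw \<phi> A B" "\<And>a. a \<in> A \<Longrightarrow> w a = v (\<phi> a)" "\<And>a. a \<in> A \<Longrightarrow> g a = h (\<phi> a)"
  shows "gf A w g = gf B v h"
proof (rule fps_ext)
  fix n
  have "bij_betw \<phi> {a \<in> A. w a = n} {b \<in> B. v b = n}"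
    using assms(1,2) by (auto simp: bij_betw_def inj_on_def image_iff)
  then have "(\<Sum>a | a \<in> A \<and> w a = n. h (\<phi> a)) = (\<Sum>b | b \<in> B \<and> v b = n. h b)"
    by (rule sum.reindex_bij_betw)
  then show "gf A w g $ n = gf B v h $ n"
    unfolding gf_nth using assms(3) by (auto intro: sum.cong)
qed

lemma gf_cong:
  assumes "\<And>a. a \<in> A \<Longrightarrow> w a = v a" "\<And>a. a \<in> A \<Longrightarrow> g a = h a"
  shows "gf A w g = gf A v h"
  by (rule gf_bij[where \<phi>=id]) (use assms in auto)

lemma graded_bij:
  assumes "bij_betw \<phi> A B" "\<And>a. a \<in> A \<Longrightarrow> w a = v (\<phi> a)" "graded A w"
  shows "graded B v"
  unfolding graded_def
proof
  fix n
  have "{b \<in> B. v b = n} \<subseteq> \<phi> ` {a \<in> A. w a = n}"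
    using assms(1,2) by (auto simp: bij_betw_def)
  then show "finite {b \<in> B. v b = n}"
    using gradedD[OF assms(3)] by (rule finite_subset[OF _ finite_imageI])
qed

lemma gf_Un_disjoint:
  assumes "graded A w" "graded B w" "A \<inter> B = {}"
  shows "gf (A \<union> B) w g = gf A w g + gf B w g"
proof (rule fps_ext)
  fix n
  have "{a \<in> A \<union> B. w a = n} = {a \<in> A. w a = n} \<union> {a \<in> B. w a = n}" by auto
  then show "gf (A \<union> B) w g $ n = (gf A w g + gf B w g) $ n"
    unfolding gf_nth fps_add_nth using assms
    by (subst sum.union_disjoint[symmetric]) (auto simp: gradedD)
qed

lemma gf_shift: "gf A (\<lambda>a. s + w a) (\<lambda>a. c * g a) = fps_const c * fps_X ^ s * gf A w g"
proof (rule fps_ext)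
  fix n
  have "{a \<in> A. s + w a = n} = (if n < s then {} else {a \<in> A. w a = n - s})" by auto
  then show "gf A (\<lambda>a. s + w a) (\<lambda>a. c * g a) $ n = (fps_const c * fps_X ^ s * gf A w g) $ n"
    by (simp add: gf_nth mult.assoc fps_X_power_mult_nth sum_distrib_left)
qed

lemma gf_singleton: "gf {a} w g = fps_const (g a) * fps_X ^ w a"
proof (rule fps_ext)
  fix n
  have "{b. b = a \<and> w b = n} = (if w a = n then {a} else {})" by auto
  then show "gf {a} w g $ n = (fps_const (g a) * fps_X ^ w a) $ n"
    by (simp add: gf_nth fps_X_power_nth)
qed

lemma gf_Times:
  assumes "graded A w" "graded B v"
  shows "gf (A \<times> B) (\<lambda>(a, b). w a + v b) (\<lambda>(a, b). g a * h b) = gf A w g * gf B v h"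
proof (rule fps_ext)
  fix n
  let ?A = "\<lambda>k. {a \<in> A. w a = k}" and ?B = "\<lambda>k. {b \<in> B. v b = k}"
  \<comment> \<open>Splitting the fibre over \<open>n\<close> by the value \<open>k\<close> of
    \<open>w\<close> produces the Cauchy product.\<close>
  have eq: "{p \<in> A \<times> B. (case p of (a, b) \<Rightarrow> w a + v b) = n} = (\<Union>k\<in>{0..n}. ?A k \<times> ?B (n - k))"
    by auto
  have "gf (A \<times> B) (\<lambda>(a, b). w a + v b) (\<lambda>(a, b). g a * h b) $ n
      = (\<Sum>p\<in>(\<Union>k\<in>{0..n}. ?A k \<times> ?B (n - k)). case p of (a, b) \<Rightarrow> g a * h b)"
    unfolding gf_nth eq ..
  also have "\<dots> = (\<Sum>k=0..n. \<Sum>p\<in>?A k \<times> ?B (n - k). case p of (a, b) \<Rightarrow> g a * h b)"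
    by (rule sum.UNION_disjoint) (use assms in \<open>auto simp: gradedD\<close>)
  also have "\<dots> = (gf A w g * gf B v h) $ n"
    unfolding fps_mult_nth gf_nth by (simp add: sum_product sum.cartesian_product)
  finally show "gf (A \<times> B) (\<lambda>(a, b). w a + v b) (\<lambda>(a, b). g a * h b) $ n = (gf A w g * gf B v h) $ n" .
qed

lemma graded_Times:
  assumes "graded A w" "graded B v"
  shows "graded (A \<times> B) (\<lambda>(a, b). w a + v b)"
  unfolding graded_def
proof
  fix n
  have "{p \<in> A \<times> B. (case p of (a, b) \<Rightarrow> w a + v b) = n}
      = (\<Union>k\<in>{0..n}. {a \<in> A. w a = k} \<times> {b \<in> B. v b = n - k})"
    by auto
  then show "finite {p \<in> A \<times> B. (case p of (a, b) \<Rightarrow> w a + v b) = n}"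
    using assms by (simp add: gradedD)
qed

text \<open>Used for the quotient, an \<open>m\<close>-tuple of partitions. Both claims go through
  one induction because multiplying by one more factor requires the product so far to be
  graded.\<close>

lemma gf_PiE:
  assumes "graded A w"
  shows "graded (PiE {..<k} (\<lambda>_. A)) (\<lambda>f. \<Sum>i<k. w (f i)) \<and>
    gf (PiE {..<k} (\<lambda>_. A)) (\<lambda>f. \<Sum>i<k. w (f i)) (\<lambda>_. 1 :: 'c::comm_ring_1) = gf A w (\<lambda>_. 1) ^ k"
proof (induction k)
  case 0
  show ?case by (auto simp: gf_singleton graded_def)
next
  case (Suc k)
  let ?P = "\<lambda>k. PiE {..<k} (\<lambda>_. A)" and ?w = "\<lambda>k f. \<Sum>i<k. w (f i)"
  define \<phi> where "\<phi> = (\<lambda>(a, f). f(k := a) :: nat \<Rightarrow> 'a)"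
  have inj: "inj_on \<phi> (A \<times> ?P k)"
    using inj_combinator[of k "{..<k}" "\<lambda>_. A"] by (simp add: \<phi>_def)
  have "\<phi> ` (A \<times> ?P k) = ?P (Suc k)"
    using PiE_insert_eq[of k "{..<k}" "\<lambda>_. A"] by (simp add: \<phi>_def lessThan_Suc)
  with inj have bij: "bij_betw \<phi> (A \<times> ?P k) (?P (Suc k))"
    by (simp add: bij_betw_def)
  have w: "(case p of (a, f) \<Rightarrow> w a + ?w k f) = ?w (Suc k) (\<phi> p)" if "p \<in> A \<times> ?P k" for p
  proof -
    obtain a f where p: "p = (a, f)" by (cases p)
    have "?w k (f(k := a)) = ?w k f" by (rule sum.cong) auto
    then show ?thesis by (simp add: p \<phi>_def add.commute)
  qed
  have "gf (?P (Suc k)) (?w (Suc k)) (\<lambda>_. 1 :: 'c) = gf (A \<times> ?P k) (\<lambda>(a, f). w a + ?w k f) (\<lambda>_. 1)"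
    by (rule gf_bij[where v = "?w (Suc k)" and w = "\<lambda>(a, f). w a + ?w k f", OF bij w, symmetric]) auto
  also have "\<dots> = gf (A \<times> ?P k) (\<lambda>(a, f). w a + ?w k f) (\<lambda>(a, f). 1 * 1)"
    by (rule gf_cong) auto
  also have "\<dots> = gf A w (\<lambda>_. 1) ^ Suc k"
    using Suc by (subst gf_Times) (auto simp: assms)
  finally show ?case
    using graded_bij[where v = "?w (Suc k)" and w = "\<lambda>(a, f). w a + ?w k f",
        OF bij w graded_Times[OF assms]] Suc by blast
qed

section \<open>Congruence of power series modulo q^(n+1), and infinite products\<close>

definition eq_upto :: "nat \<Rightarrow> 'a::comm_ring_1 fps \<Rightarrow> 'a fps \<Rightarrow> bool" where
  "eq_upto n f g \<longleftrightarrow> (\<forall>k\<le>n. f $ k = g $ k)"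

lemma eq_upto_refl [simp]: "eq_upto n f f"
  by (simp add: eq_upto_def)

lemma eq_upto_mult: "eq_upto n f f' \<Longrightarrow> eq_upto n g g' \<Longrightarrow> eq_upto n (f * g) (f' * g')"
  by (auto simp: eq_upto_def fps_mult_nth intro!: sum.cong)

lemma eq_upto_power: "eq_upto n f g \<Longrightarrow> eq_upto n (f ^ k) (g ^ k)"
  by (induction k) (auto intro: eq_upto_mult)

lemma eq_upto_prod: "(\<And>i. i \<in> I \<Longrightarrow> eq_upto n (f i) (g i)) \<Longrightarrow> eq_upto n (prod f I) (prod g I)"
  by (induction I rule: infinite_finite_induct) (auto intro: eq_upto_mult)

lemma eq_upto_trans: "eq_upto n f g \<Longrightarrow> eq_upto n g h \<Longrightarrow> eq_upto n f h"
  by (simp add: eq_upto_def)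

lemma eq_upto_imp_eq: "(\<And>n. eq_upto n f g) \<Longrightarrow> f = g"
  by (auto simp: eq_upto_def intro: fps_ext)

text \<open>The factors of index at least \<open>k\<close> are 1 modulo q^(k+1), so the coefficient
  of q^k in the partial products is constant from \<open>k\<close> factors on. Infinite products can
  thus be replaced by finite ones in every degree.\<close>

lemma prodinf_fps_eq_upto:
  fixes f :: "nat \<Rightarrow> 'a::idom fps"
  assumes "\<And>i. eq_upto i (f i) 1"
  shows "eq_upto n (prodinf f) (\<Prod>i<n. f i)"
proof -
  define P where "P = Abs_fps (\<lambda>k. (\<Prod>i<k. f i) $ k)"
  have stable: "(\<Prod>i<N. f i) $ k = P $ k" if "k \<le> N" for N k
  proof -
    have "(\<Prod>i<N. f i) = (\<Prod>i<k. f i) * (\<Prod>i=k..<N. f i)"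
      using prod.atLeastLessThan_concat[of 0 k N f] that by (simp add: atLeast0LessThan)
    moreover have "eq_upto k (\<Prod>i=k..<N. f i) (\<Prod>i=k..<N. 1)"
      by (rule eq_upto_prod) (use assms in \<open>force simp: eq_upto_def\<close>)
    then have "eq_upto k ((\<Prod>i<k. f i) * (\<Prod>i=k..<N. f i)) ((\<Prod>i<k. f i) * 1)"
      by (intro eq_upto_mult) auto
    ultimately show ?thesis by (simp add: P_def eq_upto_def)
  qed
  have "(\<lambda>n. \<Prod>i\<le>n. f i) \<longlonglongrightarrow> P"
  proof (rule tendsto_fpsI)
    fix k
    show "\<forall>\<^sub>F n in sequentially. (\<Prod>i\<le>n. f i) $ k = P $ k"
      using eventually_ge_at_top[of k]
      by eventually_elim (metis stable lessThan_Suc_atMost le_SucI)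
  qed
  \<comment> \<open>Convergence in the sense of \<open>raw_has_prod\<close> includes a nonzero
    limit; here the constant term is the empty product 1.\<close>
  moreover have "P \<noteq> 0"
  proof
    assume "P = 0"
    then have "P $ 0 = 0" by simp
    then show False by (simp add: P_def)
  qed
  ultimately have "f has_prod P"
    by (simp add: has_prod_def raw_has_prod_def)
  then have "prodinf f = P"
    using has_prod_unique by blast
  then show ?thesis
    by (simp add: eq_upto_def stable)
qed

text \<open>A denominator with constant term 1 is a unit. The assumption on \<open>inverse\<close>
  covers both coefficient rings of the theorem, the field \<open>rat\<close> and the ring
  \<open>rat fps\<close>.\<close>

lemma fps_divide_eqI:
  fixes f :: "'a::{idom,inverse} fps"
  assumes "inverse (1::'a) = 1" "g $ 0 = 1" "f * g = h"
  shows "h / g = f"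
proof -
  have sub: "subdegree g = 0" by (simp add: assms(2))
  have "g * inverse g = 1"
    unfolding fps_inverse_def by (rule fps_right_inverse) (simp add: assms(1,2))
  then have "h * inverse g = f"
    unfolding assms(3)[symmetric] by (simp add: mult.assoc)
  then show ?thesis by (simp add: fps_divide_unit'[OF sub])
qed

section \<open>Partitions as Maya diagrams\<close>

lemma partition_antimono: "is_partition \<mu> \<Longrightarrow> i \<le> j \<Longrightarrow> \<mu> j \<le> \<mu> i"
  by (simp add: is_partition_def antimono_def)

lemma partition_support:
  assumes "is_partition \<mu>"
  obtains N where "\<And>i. N \<le> i \<Longrightarrow> \<mu> i = 0"
proof -
  have "finite {i. \<mu> i \<noteq> 0}" using assms by (simp add: is_partition_def)
  then obtain N where "\<forall>i\<in>{i. \<mu> i \<noteq> 0}. i < N"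
    using finite_nat_set_iff_bounded by blast
  then show thesis by (metis (mono_tags, lifting) mem_Collect_eq not_le that)
qed

lemma is_partitionI:
  assumes "\<And>i. \<mu> (Suc i) \<le> \<mu> i" "\<And>i. N \<le> i \<Longrightarrow> \<mu> i = 0"
  shows "is_partition \<mu>"
proof -
  have "{i. \<mu> i \<noteq> 0} \<subseteq> {..<N}" using assms(2) by (metis (mono_tags, lifting) lessThan_iff mem_Collect_eq not_le subsetI)
  then show ?thesis
    unfolding is_partition_def antimono_def
    using lift_Suc_antimono_le[of \<mu>] assms(1) by (auto intro: finite_subset)
qed

lemma is_partition_zero: "is_partition (\<lambda>_. 0)"
  by (rule is_partitionI[of _ 0]) auto

lemma psize_eq_sum:
  assumes "\<And>i. N \<le> i \<Longrightarrow> \<mu> i = 0"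
  shows "psize \<mu> = (\<Sum>i<N. \<mu> i)"
  unfolding psize_def
proof (rule sum.mono_neutral_left)
  show "{i. \<mu> i \<noteq> 0} \<subseteq> {..<N}"
    using assms by (metis (mono_tags, lifting) lessThan_iff mem_Collect_eq not_le subsetI)
qed auto

lemma card_diagram:
  assumes "is_partition \<mu>"
  shows "finite (diagram \<mu>)" "card (diagram \<mu>) = psize \<mu>"
proof -
  obtain N where N: "\<And>i. N \<le> i \<Longrightarrow> \<mu> i = 0" using partition_support[OF assms] by blast
  have eq: "diagram \<mu> = Sigma {..<N} (\<lambda>i. {..<\<mu> i})"
    using N by (auto simp: diagram_def) (metis not_le not_less_zero)
  show "finite (diagram \<mu>)" unfolding eq by simp
  show "card (diagram \<mu>) = psize \<mu>" unfolding eq using psize_eq_sum[of N \<mu>] N by simp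
qed

text \<open>The charge \<open>c\<close> is the level below which the empty partition fills every
  position. Nonzero charges are required because the runners of a diagram of charge 0 need not have
  charge 0.\<close>

definition bead :: "int \<Rightarrow> (nat \<Rightarrow> nat) \<Rightarrow> nat \<Rightarrow> int" where
  "bead c \<mu> i = c + int (\<mu> i) - int i - 1"

definition beads :: "int \<Rightarrow> (nat \<Rightarrow> nat) \<Rightarrow> int set" where
  "beads c \<mu> = range (bead c \<mu>)"

lemma bead_strict: "is_partition \<mu> \<Longrightarrow> i < j \<Longrightarrow> bead c \<mu> j < bead c \<mu> i"
  using partition_antimono[of \<mu> i j] by (simp add: bead_def)

lemma bead_less_iff: "is_partition \<mu> \<Longrightarrow> bead c \<mu> j < bead c \<mu> i \<longleftrightarrow> i < j"
  by (metis bead_strict not_less_iff_gr_or_eq order_less_asym)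

lemma bead_eq_iff: "is_partition \<mu> \<Longrightarrow> bead c \<mu> i = bead c \<mu> j \<longleftrightarrow> i = j"
  by (metis bead_strict less_irrefl nat_neq_iff)

text \<open>\<open>bead\<close> lists the set in decreasing order, so the set determines the list;
  far out, where both partitions vanish, the list shows the charge.\<close>

lemma beads_unique:
  assumes "is_partition \<mu>" "is_partition \<nu>" "beads c \<mu> = beads d \<nu>"
  shows "c = d" "\<mu> = \<nu>"
proof -
  have eq: "bead c \<mu> n = bead d \<nu> n" for n
  proof (induction n rule: less_induct)
    case (less n)
    obtain k where k: "bead d \<nu> n = bead c \<mu> k"
      using assms(3) unfolding beads_def by (metis UNIV_I imageE image_eqI)
    obtain l where l: "bead c \<mu> n = bead d \<nu> l"
      using assms(3) unfolding beads_def by (metis UNIV_I imageE image_eqI)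
    \<comment> \<open>An index below \<open>n\<close> would, by the induction hypothesis, give one
      bead two indices. So \<open>k\<close> and \<open>l\<close> are at least \<open>n\<close>,
      which bounds each of the two beads by the other.\<close>
    have "\<not> k < n"
      using k less.IH[of k] bead_eq_iff[OF assms(2)] by (metis nat_neq_iff)
    moreover have "\<not> l < n"
      using l less.IH[of l] bead_eq_iff[OF assms(1)] by (metis nat_neq_iff)
    ultimately show ?case
      using k l bead_strict[OF assms(1), of n k c] bead_strict[OF assms(2), of n l d]
      by (metis less_asym nat_neq_iff)
  qed
  obtain M where "\<And>i. M \<le> i \<Longrightarrow> \<mu> i = 0" using partition_support[OF assms(1)] by blast
  moreover obtain N where "\<And>i. N \<le> i \<Longrightarrow> \<nu> i = 0" using partition_support[OF assms(2)] by blast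
  ultimately show "c = d" using eq[of "max M N"] by (simp add: bead_def)
  then show "\<mu> = \<nu>" using eq by (auto simp: bead_def)
qed

lemma beads_zero: "beads c (\<lambda>_. 0) = {..<c}"
proof (intro equalityI subsetI)
  fix x assume "x \<in> {..<c}"
  then have "x = bead c (\<lambda>_. 0) (nat (c - 1 - x))" by (simp add: bead_def)
  then show "x \<in> beads c (\<lambda>_. 0)" by (simp add: beads_def)
qed (auto simp: beads_def bead_def)

text \<open>
  A Maya diagram is a set of integers that agrees with a half-line up to finitely many elements;
  \<open>charge\<close> and \<open>shape\<close> are its coordinates as \<open>beads c \<mu>\<close>.
\<close>

definition maya :: "int set \<Rightarrow> bool" where
  "maya S \<longleftrightarrow> (\<exists>a b. {..<a} \<subseteq> S \<and> S \<subseteq> {..<b})"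

lemma maya_beads:
  assumes "is_partition \<mu>"
  shows "maya (beads c \<mu>)"
proof -
  obtain N where N: "\<And>i. N \<le> i \<Longrightarrow> \<mu> i = 0" using partition_support[OF assms] by blast
  have "{..<c - int N} \<subseteq> beads c \<mu>"
  proof
    fix x assume x: "x \<in> {..<c - int N}"
    then have "x = bead c \<mu> (nat (c - 1 - x))"
      using N[of "nat (c - 1 - x)"] by (simp add: bead_def)
    then show "x \<in> beads c \<mu>" by (simp add: beads_def)
  qed
  moreover have "beads c \<mu> \<subseteq> {..<c + int (\<mu> 0)}"
    using partition_antimono[OF assms, of 0] by (auto simp: beads_def bead_def) (smt (verit) of_nat_mono of_nat_0_le_iff)
  ultimately show ?thesis unfolding maya_def by blast
qed

text \<open>Induction on the length of the window between the filled half-line and the empty one: an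
  occupied top position is taken out and put back as a new largest part.\<close>

lemma maya_exists:
  assumes "maya S"
  shows "\<exists>c \<mu>. is_partition \<mu> \<and> S = beads c \<mu>"
proof -
  obtain a b where ab: "{..<a} \<subseteq> S" "S \<subseteq> {..<b}" using assms unfolding maya_def by blast
  have "\<exists>c \<mu>. is_partition \<mu> \<and> S = beads c \<mu>"
    if "{..<a} \<subseteq> S" "S \<subseteq> {..<a + int n}" for n S
    using that
  proof (induction n arbitrary: S)
    case 0
    then have "S = beads a (\<lambda>_. 0)" by (simp add: beads_zero)
    then show ?case using is_partition_zero by blast
  next
    case (Suc n)
    define b where "b = a + int n"
    show ?case
    proof (cases "b \<in> S")
      case False
      have "S \<subseteq> {..<a + int n}"
      proof
        fix x assume "x \<in> S"
        with False Suc.prems(2) show "x \<in> {..<a + int n}"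
          by (cases "x = b") (auto simp: b_def)
      qed
      then show ?thesis using Suc by blast
    next
      case True
      have "S - {b} \<subseteq> {..<a + int n}" using Suc.prems(2) by (auto simp: b_def)
      moreover have "{..<a} \<subseteq> S - {b}" using Suc.prems(1) by (auto simp: b_def)
      ultimately obtain c \<mu> where \<mu>: "is_partition \<mu>" "S - {b} = beads c \<mu>"
        using Suc.IH by blast
      then have "bead c \<mu> 0 < b" using \<open>S - {b} \<subseteq> _\<close> by (force simp: beads_def b_def)
      then have b: "c + int (\<mu> 0) \<le> b" by (simp add: bead_def)
      \<comment> \<open>Prepending a part shifts all indices by one, which the charge
        \<open>c + 1\<close> compensates; the new part \<open>b - c\<close> then puts its bead at
        \<open>b\<close>. It is at least \<open>\<mu> 0\<close>, since all other beads lie below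
        \<open>b\<close>.\<close>
      define \<nu> where "\<nu> = case_nat (nat (b - c)) \<mu>"
      obtain N where N: "\<And>i. N \<le> i \<Longrightarrow> \<mu> i = 0" using partition_support[OF \<mu>(1)] by blast
      have "is_partition \<nu>"
      proof (rule is_partitionI)
        show "\<nu> (Suc i) \<le> \<nu> i" for i
          using b partition_antimono[OF \<mu>(1)] by (cases i) (auto simp: \<nu>_def)
        show "\<nu> i = 0" if "Suc N \<le> i" for i
          using N that by (cases i) (auto simp: \<nu>_def)
      qed
      moreover have b0: "bead (c + 1) \<nu> 0 = b" and bS: "bead (c + 1) \<nu> (Suc i) = bead c \<mu> i" for i
        using b by (auto simp: bead_def \<nu>_def)
      have "beads (c + 1) \<nu> = insert b (beads c \<mu>)"
      proof -
        have "range (bead (c + 1) \<nu>) = insert (bead (c + 1) \<nu> 0) ((\<lambda>i. bead (c + 1) \<nu> (Suc i)) ` UNIV)"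
          by (subst UNIV_nat_eq) (simp add: image_image)
        then show ?thesis by (simp add: beads_def b0 bS)
      qed
      then have "S = beads (c + 1) \<nu>" using \<mu>(2) insert_Diff[OF True] by simp
      ultimately show ?thesis by blast
    qed
  qed
  from this[of S "nat (b - a)"] ab show ?thesis by force
qed

definition charge :: "int set \<Rightarrow> int" where
  "charge S = (THE c. \<exists>\<mu>. is_partition \<mu> \<and> S = beads c \<mu>)"

definition shape :: "int set \<Rightarrow> nat \<Rightarrow> nat" where
  "shape S = (THE \<mu>. is_partition \<mu> \<and> S = beads (charge S) \<mu>)"

lemma charge_beads: "is_partition \<mu> \<Longrightarrow> charge (beads c \<mu>) = c"
  unfolding charge_def by (rule the_equality) (auto dest: beads_unique)

lemma shape_beads: "is_partition \<mu> \<Longrightarrow> shape (beads c \<mu>) = \<mu>"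
  unfolding shape_def charge_beads by (rule the_equality) (auto dest: beads_unique)

lemma maya_coords:
  assumes "maya S"
  shows "is_partition (shape S)" "beads (charge S) (shape S) = S"
  using maya_exists[OF assms] by (auto simp: charge_beads shape_beads)

section \<open>Rim hooks and bead moves\<close>

text \<open>
  The rim hook occupies the rows \<open>i\<close> to \<open>k\<close>, and consecutive rows of it overlap in exactly one column;
  the last equation says that it has \<open>m\<close> cells.
\<close>

definition rim_hook_rows :: "nat \<Rightarrow> (nat \<Rightarrow> nat) \<Rightarrow> (nat \<Rightarrow> nat) \<Rightarrow> nat \<Rightarrow> nat \<Rightarrow> bool" where
  "rim_hook_rows m \<mu> \<nu> i k \<longleftrightarrow> i \<le> k \<and> (\<forall>j. j < i \<or> k < j \<longrightarrow> \<nu> j = \<mu> j) \<and>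
     (\<forall>j. i \<le> j \<and> j < k \<longrightarrow> Suc (\<nu> j) = \<mu> (Suc j)) \<and>
     \<mu> (Suc k) \<le> \<nu> k \<and> \<nu> k < \<mu> k \<and> \<mu> i + k = \<nu> k + i + m"

context
  fixes m \<mu> \<nu> i k
  assumes part: "is_partition \<mu>" and rows: "rim_hook_rows m \<mu> \<nu> i k"
begin

lemma rim_hook_rowsD:
  "i \<le> k" "j < i \<Longrightarrow> \<nu> j = \<mu> j" "k < j \<Longrightarrow> \<nu> j = \<mu> j"
  "i \<le> j \<Longrightarrow> j < k \<Longrightarrow> Suc (\<nu> j) = \<mu> (Suc j)"
  "\<mu> (Suc k) \<le> \<nu> k" "\<nu> k < \<mu> k" "\<mu> i + k = \<nu> k + i + m"
  using rows by (auto simp: rim_hook_rows_def)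

lemma rim_hook_rows_less:
  assumes "i \<le> j" "j \<le> k"
  shows "\<nu> j < \<mu> j"
proof (cases "j = k")
  case False
  then have "Suc (\<nu> j) = \<mu> (Suc j)" using assms rim_hook_rowsD(4) by simp
  also have "\<dots> \<le> \<mu> j" by (simp add: partition_antimono[OF part])
  finally show ?thesis by simp
qed (simp add: rim_hook_rowsD)

lemma rim_hook_rows_le: "\<nu> j \<le> \<mu> j"
  using rim_hook_rows_less[of j] rim_hook_rowsD(2,3)[of j] by force

lemma rim_hook_rows_partition: "is_partition \<nu>"
proof -
  obtain N where N: "\<And>j. N \<le> j \<Longrightarrow> \<mu> j = 0" using partition_support[OF part] by blast
  show ?thesis
  proof (rule is_partitionI)
    show "\<nu> j = 0" if "N \<le> j" for j using rim_hook_rows_le[of j] N[OF that] by simp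
    fix j
    have anti: "\<mu> (Suc j) \<le> \<mu> j" "\<mu> (Suc (Suc j)) \<le> \<mu> (Suc j)"
      by (simp_all add: partition_antimono[OF part])
    consider "j < i" | "i \<le> j" "Suc j < k" | "i \<le> j" "Suc j = k" | "j = k" | "k < j"
      by linarith
    then show "\<nu> (Suc j) \<le> \<nu> j"
    proof cases
      case 1
      then show ?thesis using rim_hook_rows_le[of "Suc j"] anti rim_hook_rowsD(2)[of j] by simp
    next
      case 2
      then show ?thesis using rim_hook_rowsD(4)[of j] rim_hook_rowsD(4)[of "Suc j"] anti by simp
    next
      case 3
      then show ?thesis using rim_hook_rowsD(4)[of j] rim_hook_rowsD(6) by simp
    next
      case 4
      then show ?thesis using rim_hook_rowsD(3)[of "Suc j"] rim_hook_rowsD(5) by simp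
    next
      case 5
      then show ?thesis using rim_hook_rowsD(3)[of j] rim_hook_rowsD(3)[of "Suc j"] anti by simp
    qed
  qed
qed

lemma rim_hook_rows_psize: "psize \<mu> = psize \<nu> + m"
proof -
  obtain N where N: "\<And>j. N \<le> j \<Longrightarrow> \<mu> j = 0" using partition_support[OF part] by blast
  have N': "\<nu> j = 0" if "N \<le> j" for j using rim_hook_rows_le[of j] N[OF that] by simp
  \<comment> \<open>Telescoping: row \<open>j\<close> loses
    \<open>\<mu> j - \<mu> (Suc j) + 1\<close> cells, so rows \<open>i\<close> to
    \<open>n - 1\<close> lose \<open>\<mu> i - \<mu> n + n - i\<close>. The additive form avoids
    truncated subtraction.\<close>
  have *: "(\<Sum>j<n. \<nu> j) + n + \<mu> i = (\<Sum>j<n. \<mu> j) + \<mu> n + i" if "i \<le> n" "n \<le> k" for n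
    using that
  proof (induction n rule: dec_induct)
    case base
    have "(\<Sum>j<i. \<nu> j) = (\<Sum>j<i. \<mu> j)" by (rule sum.cong) (auto simp: rim_hook_rowsD(2))
    then show ?case by simp
  next
    case (step n)
    then show ?case using rim_hook_rowsD(4)[of n] by simp
  qed
  have "(\<Sum>j<n. \<nu> j) + m = (\<Sum>j<n. \<mu> j)" if "Suc k \<le> n" for n
    using that
  proof (induction n rule: dec_induct)
    case base
    show ?case using *[of k] rim_hook_rowsD(1,7) by simp
  next
    case (step n)
    then show ?case using rim_hook_rowsD(3)[of n] by simp
  qed
  from this[of "max N (Suc k)"] psize_eq_sum[of "max N (Suc k)" \<mu>] psize_eq_sum[of "max N (Suc k)" \<nu>] N N'
  show ?thesis by simp
qed

text \<open>For \<open>i \<le> j < k\<close>, row \<open>j\<close> of \<open>\<nu>\<close> inherits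
  the bead of row \<open>j + 1\<close> of \<open>\<mu>\<close>, and row \<open>k\<close> receives
  the bead at the new position. As sets, only the bead of row \<open>i\<close> has moved.\<close>

lemma rim_hook_rows_beads: "beads c \<nu> = insert (bead c \<mu> i - int m) (beads c \<mu> - {bead c \<mu> i})"
proof -
  have beadk: "bead c \<nu> k = bead c \<mu> i - int m"
    using rim_hook_rowsD(7) by (simp add: bead_def)
  have bead: "bead c \<nu> j = bead c \<mu> (if i \<le> j \<and> j < k then Suc j else j)" if "j \<noteq> k" for j
    using that rim_hook_rowsD(2,3,4)[of j] by (auto simp: bead_def)
  show ?thesis
  proof (intro equalityI subsetI)
    fix x assume "x \<in> beads c \<nu>"
    then obtain j where j: "x = bead c \<nu> j" by (auto simp: beads_def)
    show "x \<in> insert (bead c \<mu> i - int m) (beads c \<mu> - {bead c \<mu> i})"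
    proof (cases "j = k")
      case False
      then show ?thesis
        using j bead[OF False] rim_hook_rowsD(1)
        by (auto simp: beads_def bead_eq_iff[OF part] split: if_splits)
    qed (simp add: j beadk)
  next
    fix x assume x: "x \<in> insert (bead c \<mu> i - int m) (beads c \<mu> - {bead c \<mu> i})"
    show "x \<in> beads c \<nu>"
    proof (cases "x = bead c \<mu> i - int m")
      case True
      then show ?thesis using beadk by (metis beads_def rangeI)
    next
      case False
      with x obtain l where l: "x = bead c \<mu> l" "l \<noteq> i" by (auto simp: beads_def)
      show ?thesis
      proof (cases "i < l \<and> l \<le> k")
        case True
        then have "x = bead c \<nu> (l - 1)" using l bead[of "l - 1"] by auto
        then show ?thesis by (simp add: beads_def)
      next
        case False
        then have "x = bead c \<nu> l" using l bead[of l] rim_hook_rowsD(1) by auto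
        then show ?thesis by (simp add: beads_def)
      qed
    qed
  qed
qed

text \<open>The new position lies strictly between the consecutive beads of rows
  \<open>k + 1\<close> and \<open>k\<close>.\<close>

lemma rim_hook_rows_notin_beads: "bead c \<mu> i - int m \<notin> beads c \<mu>"
proof
  assume "bead c \<mu> i - int m \<in> beads c \<mu>"
  then obtain l where l: "bead c \<mu> i - int m = bead c \<mu> l" by (auto simp: beads_def)
  have "bead c \<mu> (Suc k) < bead c \<mu> l" "bead c \<mu> l < bead c \<mu> k"
    using rim_hook_rowsD(5,6,7) l by (auto simp: bead_def)
  then show False by (simp add: bead_less_iff[OF part])
qed

text \<open>Connects rim hooks with the hook-length definition of a core: the hook at the top row
  and leftmost column of a rim hook has the same two ends, hence the same length.\<close>

lemma rim_hook_rows_hook_length: "(i, \<nu> k) \<in> diagram \<mu>" "hook_length \<mu> (i, \<nu> k) = m"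
proof -
  have ik: "\<nu> k < \<mu> i" using rim_hook_rowsD(1,6) partition_antimono[OF part, of i k] by simp
  then show "(i, \<nu> k) \<in> diagram \<mu>" by (simp add: diagram_def)
  have "{j. \<nu> k < j \<and> (i, j) \<in> diagram \<mu>} = {\<nu> k<..<\<mu> i}" by (auto simp: diagram_def)
  moreover have "{r. i < r \<and> (r, \<nu> k) \<in> diagram \<mu>} = {i<..k}"
  proof -
    \<comment> \<open>The column of the last cell of the rim hook ends exactly in row
      \<open>k\<close>.\<close>
    have iff: "\<nu> k < \<mu> r \<longleftrightarrow> r \<le> k" for r
    proof (cases "r \<le> k")
      case True
      then show ?thesis
        using partition_antimono[OF part True] rim_hook_rowsD(6) by simp
    next
      case False
      then have "\<mu> r \<le> \<mu> (Suc k)" using partition_antimono[OF part, of "Suc k" r] by simp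
      also have "\<dots> \<le> \<nu> k" by (rule rim_hook_rowsD(5))
      finally show ?thesis using False by simp
    qed
    show ?thesis
      by (rule set_eqI) (simp add: diagram_def iff)
  qed
  ultimately show "hook_length \<mu> (i, \<nu> k) = m"
    using ik rim_hook_rowsD(1,7) by (simp add: hook_length_def arm_def leg_def)
qed

text \<open>Every cell is joined to the bottom left cell \<open>(k, \<nu> k)\<close> by walking left
  to the end of its row, stepping down, and repeating. A single common column of consecutive rows
  leaves no room for a square.\<close>

lemma rim_hook_rows_removes: "removes_rim_hook m \<mu> \<nu>"
proof -
  define S where "S = diagram \<mu> - diagram \<nu>"
  have S_iff: "(a, b) \<in> S \<longleftrightarrow> \<nu> a \<le> b \<and> b < \<mu> a" for a b
    by (auto simp: S_def diagram_def)
  have S_rows: "i \<le> a \<and> a \<le> k" if "(a, b) \<in> S" for a b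
    using that rim_hook_rowsD(2,3)[of a] by (force simp: S_iff)
  have sub: "diagram \<nu> \<subseteq> diagram \<mu>"
    using rim_hook_rows_le by (auto simp: diagram_def intro: less_le_trans)
  have "card S = m"
    unfolding S_def using card_diagram[OF part] card_diagram[OF rim_hook_rows_partition]
    by (simp add: card_Diff_subset sub rim_hook_rows_psize)
  moreover have "edge_connected S"
  proof -
    let ?R = "\<lambda>x y. x \<in> S \<and> y \<in> S \<and> adjacent x y"
    have row: "?R\<^sup>*\<^sup>* (a, \<nu> a + d) (a, \<nu> a)" if "(a, \<nu> a + d) \<in> S" for a d
      using that
    proof (induction d)
      case (Suc d)
      then have d: "(a, \<nu> a + d) \<in> S" by (simp add: S_iff)
      then have "?R (a, \<nu> a + Suc d) (a, \<nu> a + d)" using Suc.prems by (simp add: adjacent_def)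
      then show ?case using Suc.IH[OF d] by (rule converse_rtranclp_into_rtranclp)
    qed simp
    \<comment> \<open>The column \<open>\<nu> a\<close> is the one that rows \<open>a\<close> and
      \<open>a + 1\<close> share, so below \<open>(a, \<nu> a)\<close> lies the rightmost cell of
      row \<open>a + 1\<close>.\<close>
    have down: "?R\<^sup>*\<^sup>* (a, \<nu> a) (k, \<nu> k)" if "i \<le> a" "a \<le> k" for a
      using that(2,1)
    proof (induction a rule: inc_induct)
      case (step a)
      have eq: "Suc (\<nu> a) = \<mu> (Suc a)" using step rim_hook_rowsD(4) by simp
      have "\<nu> (Suc a) \<le> \<nu> a" using partition_antimono[OF rim_hook_rows_partition] by simp
      then obtain d where d: "\<nu> a = \<nu> (Suc a) + d" using le_Suc_ex by blast
      have S: "(a, \<nu> a) \<in> S" "(Suc a, \<nu> a) \<in> S"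
        using eq step d rim_hook_rows_less[of a] by (auto simp: S_iff)
      then have "?R (a, \<nu> a) (Suc a, \<nu> a)" by (simp add: adjacent_def)
      moreover have "?R\<^sup>*\<^sup>* (Suc a, \<nu> a) (Suc a, \<nu> (Suc a))" using row S(2) d by simp
      moreover have "?R\<^sup>*\<^sup>* (Suc a, \<nu> (Suc a)) (k, \<nu> k)" using step by simp
      ultimately show ?case
        by (rule converse_rtranclp_into_rtranclp[OF _ rtranclp_trans])
    qed simp
    have to_end: "?R\<^sup>*\<^sup>* v (k, \<nu> k)" if "v \<in> S" for v
    proof -
      obtain a b where v: "v = (a, b)" by (cases v)
      with that have "\<nu> a \<le> b" by (simp add: S_iff)
      then obtain d where "b = \<nu> a + d" using le_Suc_ex by blast
      moreover have "?R\<^sup>*\<^sup>* (a, \<nu> a) (k, \<nu> k)" using down S_rows that v by blast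
      ultimately show ?thesis using row[of a d] that v by (simp add: rtranclp_trans)
    qed
    have "symp ?R" by (auto simp: symp_def adjacent_def)
    then have "symp ?R\<^sup>*\<^sup>*" by (rule symp_rtranclp)
    then show ?thesis
      unfolding edge_connected_def using to_end by (blast intro: rtranclp_trans dest: sympD)
  qed
  moreover have "\<nexists>a b. {(a, b), (Suc a, b), (a, Suc b), (Suc a, Suc b)} \<subseteq> S"
  proof (intro notI, elim exE)
    fix a b assume ab: "{(a, b), (Suc a, b), (a, Suc b), (Suc a, Suc b)} \<subseteq> S"
    then have "i \<le> a" "Suc a \<le> k" using S_rows by auto
    then have "Suc (\<nu> a) = \<mu> (Suc a)" using rim_hook_rowsD(4) by simp
    then show False using ab by (auto simp: S_iff)
  qed
  ultimately show ?thesis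
    unfolding removes_rim_hook_def Let_def S_def[symmetric]
    using part rim_hook_rows_partition sub by blast
qed

end

text \<open>Connectedness makes consecutive rows overlap in at least one column, and the absence of
  squares in at most one.\<close>

lemma removes_rim_hook_rows:
  assumes "removes_rim_hook m \<mu> \<nu>" "0 < m"
  shows "\<exists>i k. rim_hook_rows m \<mu> \<nu> i k"
proof -
  define S where "S = diagram \<mu> - diagram \<nu>"
  have part: "is_partition \<mu>" "is_partition \<nu>" and sub: "diagram \<nu> \<subseteq> diagram \<mu>"
    and card: "card S = m" and conn: "edge_connected S"
    and no_square: "\<And>a b. \<not> {(a, b), (Suc a, b), (a, Suc b), (Suc a, Suc b)} \<subseteq> S"
    using assms(1) by (auto simp: removes_rim_hook_def Let_def S_def)
  have S_iff: "(a, b) \<in> S \<longleftrightarrow> \<nu> a \<le> b \<and> b < \<mu> a" for a b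
    by (auto simp: S_def diagram_def)
  have le: "\<nu> a \<le> \<mu> a" for a
  proof (rule ccontr)
    assume "\<not> \<nu> a \<le> \<mu> a"
    then have "(a, \<mu> a) \<in> diagram \<nu> - diagram \<mu>" by (simp add: diagram_def)
    with sub show False by blast
  qed
  define R where "R = {a. \<nu> a < \<mu> a}"
  have R_eq: "R = fst ` S" by (auto simp: R_def S_iff image_iff Bex_def intro: le_less_trans)
  have "finite S" "S \<noteq> {}" using card assms(2) by (auto intro: card_ge_0_finite)
  then have R: "finite R" "R \<noteq> {}" unfolding R_eq by auto
  define i k where "i = Min R" and "k = Max R"
  have ik: "i \<in> R" "k \<in> R" "i \<le> k" using R by (auto simp: i_def k_def)
  have out: "\<nu> a = \<mu> a" if "a < i \<or> k < a" for a
  proof (rule ccontr)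
    assume "\<nu> a \<noteq> \<mu> a"
    then have "a \<in> R" using le[of a] by (simp add: R_def)
    then show False using that R by (auto simp: i_def k_def)
  qed
  have step: "Suc (\<nu> a) = \<mu> (Suc a)" if a: "i \<le> a" "a < k" for a
  proof (rule antisym)
    show "Suc (\<nu> a) \<le> \<mu> (Suc a)"
    proof (rule ccontr)
      assume "\<not> Suc (\<nu> a) \<le> \<mu> (Suc a)"
      \<comment> \<open>Without a common column of rows \<open>a\<close> and \<open>a + 1\<close>,
        no path in \<open>S\<close> leaves the rows up to \<open>a\<close>, so row \<open>k\<close>
        cannot be reached from row \<open>i\<close>.\<close>
      then have cut: "fst y \<le> a" if "x \<in> S" "y \<in> S" "adjacent x y" "fst x \<le> a" for x y
      proof -
        obtain p q where x: "x = (p, q)" by (cases x)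
        obtain p' q' where y: "y = (p', q')" by (cases y)
        have "\<not> (p = a \<and> p' = Suc a)"
          using that \<open>\<not> Suc (\<nu> a) \<le> \<mu> (Suc a)\<close> by (auto simp: x y S_iff adjacent_def)
        then show ?thesis using that by (auto simp: x y adjacent_def)
      qed
      have "(\<lambda>x y. x \<in> S \<and> y \<in> S \<and> adjacent x y)\<^sup>*\<^sup>* (i, \<nu> i) (k, \<nu> k)"
        using conn ik unfolding edge_connected_def R_def by (auto simp: S_iff)
      then have "fst (k, \<nu> k) \<le> a"
        by (induction rule: rtranclp_induct) (use a cut in auto)
      then show False using a by simp
    qed
    show "\<mu> (Suc a) \<le> Suc (\<nu> a)"
    proof (rule ccontr)
      assume "\<not> \<mu> (Suc a) \<le> Suc (\<nu> a)"
      moreover have "\<nu> (Suc a) \<le> \<nu> a" "\<mu> (Suc a) \<le> \<mu> a"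
        using part by (auto intro: partition_antimono)
      ultimately have "{(a, \<nu> a), (Suc a, \<nu> a), (a, Suc (\<nu> a)), (Suc a, Suc (\<nu> a))} \<subseteq> S"
        by (auto simp: S_iff)
      with no_square show False by blast
    qed
  qed
  have "\<mu> (Suc k) \<le> \<nu> k"
    using out[of "Suc k"] partition_antimono[OF part(2), of k "Suc k"] by simp
  moreover have "\<nu> k < \<mu> k" using ik by (simp add: R_def)
  moreover have "\<nu> k + i \<le> \<mu> i + k"
    using ik partition_antimono[OF part(1), of i k] by (simp add: R_def)
  \<comment> \<open>The row description holds for the length read off from its end points; comparing
    sizes afterwards identifies this length with \<open>m\<close>.\<close>
  ultimately have rows: "rim_hook_rows (\<mu> i + k - (\<nu> k + i)) \<mu> \<nu> i k"
    using ik out step by (simp add: rim_hook_rows_def)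
  have "m = psize \<mu> - psize \<nu>"
    unfolding card[symmetric] S_def using card_diagram[OF part(1)] card_diagram[OF part(2)]
    by (simp add: card_Diff_subset sub)
  then have "m = \<mu> i + k - (\<nu> k + i)" using rim_hook_rows_psize[OF part(1) rows] by simp
  with rows show ?thesis by blast
qed

text \<open>The converse of \<open>rim_hook_rows_beads\<close>: whenever the position
  \<open>m\<close> below a bead is vacant, moving the bead there is the removal of a rim hook of
  length \<open>m\<close>.\<close>

lemma bead_move:
  assumes part: "is_partition \<mu>" and x: "x \<in> beads c \<mu>" "x - int m \<notin> beads c \<mu>"
  shows "\<exists>\<nu> i k. rim_hook_rows m \<mu> \<nu> i k \<and> beads c \<nu> = insert (x - int m) (beads c \<mu> - {x})"
proof -
  obtain i where i: "x = bead c \<mu> i" using x(1) by (auto simp: beads_def)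
  obtain N where N: "\<And>j. N \<le> j \<Longrightarrow> \<mu> j = 0" using partition_support[OF part] by blast
  have "bead c \<mu> (N + nat (c + int m - x)) \<le> x - int m"
    using N[of "N + nat (c + int m - x)"] by (simp add: bead_def)
  \<comment> \<open>The first row whose bead is not above the target. The rim hook ends one row
    earlier, in row \<open>k = n - 1\<close>.\<close>
  define n where "n = (LEAST n. bead c \<mu> n \<le> x - int m)"
  have n: "bead c \<mu> n \<le> x - int m"
    unfolding n_def by (rule LeastI) fact
  have n_min: "x - int m < bead c \<mu> j" if "j < n" for j
    using not_less_Least[of j "\<lambda>n. bead c \<mu> n \<le> x - int m"] that unfolding n_def by simp
  have "m \<noteq> 0" using x by (cases "m = 0") auto
  then have "bead c \<mu> n < bead c \<mu> i" using n i by simp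
  then have "i < n" by (simp add: bead_less_iff[OF part])
  then obtain k where k: "n = Suc k" "i \<le> k" by (cases n) auto
  have "bead c \<mu> (Suc k) \<noteq> x - int m" using x(2) by (metis beads_def rangeI)
  then have lo: "bead c \<mu> (Suc k) < x - int m" using n k by simp
  have hi: "x - int m < bead c \<mu> k" using n_min k by simp
  \<comment> \<open>Row \<open>k\<close> gets the part whose bead sits at \<open>x - m\<close>.
    Neither \<open>nat\<close> nor the subtraction of 1 truncates: the target is above bead
    \<open>k + 1\<close>, and the parts concerned are positive by \<open>pos\<close>.\<close>
  define \<nu> where "\<nu> = (\<lambda>j. if j < i \<or> k < j then \<mu> j else if j < k then \<mu> (Suc j) - 1
    else nat (x - int m + int k + 1 - c))"
  have pos: "0 < \<mu> (Suc j)" if "i \<le> j" "j < k" for j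
    using partition_antimono[OF part, of "Suc j" k] that lo hi by (auto simp: bead_def)
  have \<nu>k: "int (\<nu> k) = x - int m + int k + 1 - c"
    using lo k by (auto simp: \<nu>_def bead_def)
  have "rim_hook_rows m \<mu> \<nu> i k"
    unfolding rim_hook_rows_def
  proof (intro conjI allI impI)
    show "Suc (\<nu> j) = \<mu> (Suc j)" if "i \<le> j \<and> j < k" for j
      using that pos[of j] by (auto simp: \<nu>_def)
    show "\<mu> (Suc k) \<le> \<nu> k" using \<nu>k lo by (simp add: bead_def)
    show "\<nu> k < \<mu> k" using \<nu>k hi by (simp add: bead_def)
    show "\<mu> i + k = \<nu> k + i + m" using \<nu>k i by (simp add: bead_def)
  qed (use k in \<open>auto simp: \<nu>_def\<close>)
  then show ?thesis using rim_hook_rows_beads[OF part] i by blast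
qed

section \<open>Cores and quotients\<close>

text \<open>A runner of the \<open>m\<close>-abacus, rescaled so that a move by \<open>m\<close>
  becomes a move by 1.\<close>

definition runner :: "nat \<Rightarrow> nat \<Rightarrow> int set \<Rightarrow> int set" where
  "runner m r S = {y. int m * y + int r \<in> S}"

lemma int_runner_position:
  assumes "0 < m"
  obtains y s where "s < m" "x = int m * y + int s"
proof
  show "nat (x mod int m) < m" using assms by (simp add: nat_less_iff)
  show "x = int m * (x div int m) + int (nat (x mod int m))" using assms by simp
qed

lemma runner_position_eq:
  assumes "s < m" "r < m"
  shows "int m * y + int s = int m * z + int r \<longleftrightarrow> y = z \<and> s = r"
proof
  assume eq: "int m * y + int s = int m * z + int r"
  have "(int m * y + int s) div int m = y" "(int m * z + int r) div int m = z"
    using assms by simp_all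
  with eq show "y = z \<and> s = r" by simp
qed simp

lemma runners_eqI:
  assumes "0 < m" "\<And>r. r < m \<Longrightarrow> runner m r S = runner m r T"
  shows "S = T"
proof (rule set_eqI)
  fix x
  obtain y s where "s < m" "x = int m * y + int s" using int_runner_position[OF assms(1)] .
  then show "x \<in> S \<longleftrightarrow> x \<in> T" using assms(2)[of s] by (auto simp: runner_def)
qed

lemma maya_runner:
  assumes "0 < m" "maya S"
  shows "maya (runner m r S)"
proof -
  obtain a b where ab: "{..<a} \<subseteq> S" "S \<subseteq> {..<b}" using assms(2) unfolding maya_def by blast
  have "{..<- \<bar>a\<bar> - int r} \<subseteq> runner m r S"
  proof
    fix y assume y: "y \<in> {..<- \<bar>a\<bar> - int r}"
    \<comment> \<open>The bound is negative whatever the sign of \<open>a\<close>, so multiplying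
      \<open>y\<close> by \<open>m\<close> can only lower it.\<close>
    then have "int m * y \<le> 1 * y" using assms(1) by (intro mult_right_mono_neg) auto
    then have "int m * y + int r < a" using y by auto
    then show "y \<in> runner m r S" using ab(1) by (auto simp: runner_def)
  qed
  moreover have "runner m r S \<subseteq> {..<\<bar>b\<bar> + 1}"
  proof
    fix y assume "y \<in> runner m r S"
    then have less: "int m * y + int r < b" using ab(2) by (auto simp: runner_def)
    show "y \<in> {..<\<bar>b\<bar> + 1}"
    proof (cases "0 \<le> y")
      case True
      then have "1 * y \<le> int m * y" using assms(1) by (intro mult_right_mono) auto
      then show ?thesis using less by auto
    qed auto
  qed
  ultimately show ?thesis unfolding maya_def by blast
qed

lemma maya_of_runners:
  assumes "0 < m" "\<And>r. r < m \<Longrightarrow> maya (runner m r S)"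
  shows "maya S"
proof -
  obtain a b where ab: "\<And>r. r < m \<Longrightarrow> {..<a r} \<subseteq> runner m r S \<and> runner m r S \<subseteq> {..<b r}"
    using assms(2) unfolding maya_def by metis
  define A where "A = Min (a ` {..<m})"
  define B where "B = Max (b ` {..<m})"
  have A: "A \<le> a r" and B: "b r \<le> B" if "r < m" for r
    using that by (auto simp: A_def B_def)
  have "{..<int m * A} \<subseteq> S"
  proof
    fix x assume x: "x \<in> {..<int m * A}"
    obtain y s where s: "s < m" "x = int m * y + int s" using int_runner_position[OF assms(1)] .
    have "int m * y + int s < int m * A" using x s by simp
    then have "int m * y < int m * A" by linarith
    then have "y < A" using assms(1) by simp
    then have "y \<in> runner m s S" using ab[OF s(1)] A[OF s(1)] by auto
    then show "x \<in> S" using s by (simp add: runner_def)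
  qed
  moreover have "S \<subseteq> {..<int m * B}"
  proof
    fix x assume x: "x \<in> S"
    obtain y s where s: "s < m" "x = int m * y + int s" using int_runner_position[OF assms(1)] .
    have "y \<in> runner m s S" using x s by (simp add: runner_def)
    then have "y + 1 \<le> B" using ab[OF s(1)] B[OF s(1)] by force
    then have "int m * (y + 1) \<le> int m * B" by (intro mult_left_mono) auto
    then show "x \<in> {..<int m * B}" using s by (simp add: distrib_left)
  qed
  ultimately show ?thesis unfolding maya_def by blast
qed

definition quotient_size :: "nat \<Rightarrow> int set \<Rightarrow> nat" where
  "quotient_size m S = (\<Sum>r<m. psize (shape (runner m r S)))"

text \<open>
  Removing a rim hook of length \<open>m\<close> moves a bead by one step on its runner, which removes a
  single cell from the shape of that runner.
\<close>

lemma rim_hook_rows_runners: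
  assumes "is_partition \<mu>" "rim_hook_rows m \<mu> \<nu> i k" "0 < m"
  shows "\<forall>r<m. charge (runner m r (beads c \<nu>)) = charge (runner m r (beads c \<mu>))"
    and "quotient_size m (beads c \<mu>) = Suc (quotient_size m (beads c \<nu>))"
proof -
  define S where "S = beads c \<mu>"
  define S' where "S' = beads c \<nu>"
  define x where "x = bead c \<mu> i"
  have x: "x \<in> S" "x - int m \<notin> S"
    using rim_hook_rows_notin_beads[OF assms(1,2)] by (auto simp: S_def x_def beads_def)
  have S': "S' = insert (x - int m) (S - {x})"
    unfolding S_def S'_def x_def by (rule rim_hook_rows_beads[OF assms(1,2)])
  obtain y s where s: "s < m" "x = int m * y + int s" using int_runner_position[OF assms(3)] .
  have shift: "x - int m = int m * (y - 1) + int s" using s by (simp add: right_diff_distrib)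
  have S'_alt: "S' = insert (int m * (y - 1) + int s) (S - {int m * y + int s})"
    using S' by (simp only: shift flip: s(2))
  have other: "runner m r S' = runner m r S" if "r < m" "r \<noteq> s" for r
    using that s(1) by (auto simp: runner_def S'_alt runner_position_eq)
  have same: "runner m s S' = insert (y - 1) (runner m s S - {y})"
    using s(1) by (auto simp: runner_def S'_alt runner_position_eq)
  define \<rho> where "\<rho> = shape (runner m s S)"
  define d where "d = charge (runner m s S)"
  have "maya (runner m s S)"
    unfolding S_def by (intro maya_runner maya_beads assms)
  then have \<rho>: "is_partition \<rho>" "runner m s S = beads d \<rho>"
    using maya_coords unfolding \<rho>_def d_def by auto
  have "y \<in> runner m s S" using x(1) s(2) by (simp add: runner_def)
  moreover have "y - 1 \<notin> runner m s S" using x(2) unfolding shift by (simp add: runner_def)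
  ultimately have "y \<in> beads d \<rho>" "y - int 1 \<notin> beads d \<rho>"
    by (simp_all flip: \<rho>(2))
  \<comment> \<open>The theory of bead moves is applied again, with length 1, to the partition on
    runner \<open>s\<close>.\<close>
  then obtain \<rho>' i' k' where \<rho>': "rim_hook_rows 1 \<rho> \<rho>' i' k'"
      "beads d \<rho>' = insert (y - int 1) (beads d \<rho> - {y})"
    using bead_move[OF \<rho>(1)] by blast
  have part': "is_partition \<rho>'" by (rule rim_hook_rows_partition[OF \<rho>(1) \<rho>'(1)])
  have S's: "runner m s S' = beads d \<rho>'" using same \<rho>' \<rho> by simp
  show "\<forall>r<m. charge (runner m r (beads c \<nu>)) = charge (runner m r (beads c \<mu>))"
    unfolding S_def[symmetric] S'_def[symmetric]
  proof (intro allI impI)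
    fix r assume "r < m"
    then show "charge (runner m r S') = charge (runner m r S)"
      using other[of r] by (cases "r = s") (auto simp: S's \<rho> charge_beads part')
  qed
  have "psize \<rho> = Suc (psize \<rho>')" using rim_hook_rows_psize[OF \<rho>(1) \<rho>'(1)] by simp
  then have "psize (shape (runner m s S)) = Suc (psize (shape (runner m s S')))"
    using S's shape_beads[OF part'] by (simp add: \<rho>_def)
  moreover have "(\<Sum>r\<in>{..<m} - {s}. psize (shape (runner m r S)))
      = (\<Sum>r\<in>{..<m} - {s}. psize (shape (runner m r S')))"
    by (rule sum.cong) (auto simp: other)
  ultimately show "quotient_size m (beads c \<mu>) = Suc (quotient_size m (beads c \<nu>))"
    unfolding quotient_size_def S_def[symmetric] S'_def[symmetric]
    using s(1) by (simp add: sum.remove[of "{..<m}" s])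
qed

text \<open>Two invariants of rim hook removal: the charges of the runners, and the size minus
  \<open>m\<close> times the quotient size. The second is written additively.\<close>

lemma rtranclp_removes_runners:
  assumes "(removes_rim_hook m)\<^sup>*\<^sup>* \<mu> \<nu>" "0 < m"
  shows "(\<forall>r<m. charge (runner m r (beads c \<mu>)) = charge (runner m r (beads c \<nu>))) \<and>
    psize \<mu> + m * quotient_size m (beads c \<nu>) = psize \<nu> + m * quotient_size m (beads c \<mu>)"
  using assms(1)
proof (induction rule: converse_rtranclp_induct)
  case (step \<mu> \<kappa>)
  then have part: "is_partition \<mu>" by (simp add: removes_rim_hook_def)
  obtain i k where rows: "rim_hook_rows m \<mu> \<kappa> i k"
    using removes_rim_hook_rows[OF step(1) assms(2)] by blast
  show ?case
    using step.IH rim_hook_rows_runners[OF part rows assms(2), of c] rim_hook_rows_psize[OF part rows]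
    by simp
qed simp

text \<open>A Maya diagram closed under steps down is the half-line below its largest bead, that is,
  the diagram of the empty partition.\<close>

lemma shape_eq_zeroI:
  assumes "maya S" "\<And>y. y \<in> S \<Longrightarrow> y - 1 \<in> S"
  shows "shape S = (\<lambda>_. 0)"
proof -
  define \<rho> where "\<rho> = shape S"
  define c where "c = charge S"
  have \<rho>: "is_partition \<rho>" "S = beads c \<rho>"
    using maya_coords[OF assms(1)] by (auto simp: \<rho>_def c_def)
  define b where "b = bead c \<rho> 0"
  have down: "b - int n \<in> S" for n
  proof (induction n)
    case 0
    then show ?case by (simp add: \<rho>(2) b_def beads_def)
  next
    case (Suc n)
    then show ?case using assms(2)[of "b - int n"] by (simp add: algebra_simps)
  qed
  have "S = {..<b + 1}"
  proof (intro equalityI subsetI)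
    fix y assume "y \<in> S"
    then obtain j where "y = bead c \<rho> j" by (auto simp: \<rho>(2) beads_def)
    then show "y \<in> {..<b + 1}"
      using bead_strict[OF \<rho>(1), of 0 j c] by (cases "j = 0") (auto simp: b_def)
  next
    fix y assume "y \<in> {..<b + 1}"
    then show "y \<in> S" using down[of "nat (b - y)"] by simp
  qed
  then have "S = beads (b + 1) (\<lambda>_. 0)" by (simp add: beads_zero)
  then show ?thesis by (simp add: shape_beads is_partition_zero)
qed

text \<open>When no bead can move down by \<open>m\<close>, every runner is a half-line and only its
  charge remains as information.\<close>

lemma runner_closed:
  assumes "0 < m" "maya S" "\<And>x. x \<in> S \<Longrightarrow> x - int m \<in> S"
  shows "runner m r S = {..<charge (runner m r S)}"
proof -
  have maya: "maya (runner m r S)" by (intro maya_runner assms)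
  have "y - 1 \<in> runner m r S" if "y \<in> runner m r S" for y
    using assms(3)[of "int m * y + int r"] that by (simp add: runner_def algebra_simps)
  then have "shape (runner m r S) = (\<lambda>_. 0)" by (rule shape_eq_zeroI[OF maya])
  then show ?thesis using maya_coords(2)[OF maya] by (simp add: beads_zero)
qed

lemma core_no_rim_hook_rows:
  assumes "is_core m \<kappa>"
  shows "\<not> rim_hook_rows m \<kappa> \<nu> i k"
  using assms rim_hook_rows_hook_length[of \<kappa> m \<nu> i k] by (auto simp: is_core_def)

text \<open>A vacant position \<open>m\<close> below a bead would give a removable rim hook and with
  it a hook of length \<open>m\<close>.\<close>

lemma core_beads_closed:
  assumes "is_core m \<kappa>" "x \<in> beads c \<kappa>"
  shows "x - int m \<in> beads c \<kappa>"
  using bead_move[of \<kappa> x c m] core_no_rim_hook_rows[OF assms(1)] assms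
  by (auto simp: is_core_def)

lemma core_quotient_size:
  assumes "is_core m \<kappa>" "0 < m"
  shows "quotient_size m (beads c \<kappa>) = 0"
proof -
  have "maya (beads c \<kappa>)" using assms by (simp add: is_core_def maya_beads)
  then have "runner m r (beads c \<kappa>) = beads (charge (runner m r (beads c \<kappa>))) (\<lambda>_. 0)" for r
    unfolding beads_zero using runner_closed[OF assms(2)] core_beads_closed[OF assms(1)] by blast
  then have "shape (runner m r (beads c \<kappa>)) = (\<lambda>_. 0)" for r
    by (metis shape_beads is_partition_zero)
  then show ?thesis by (simp add: quotient_size_def psize_def)
qed

text \<open>Remove rim hooks as long as some bead can move. At the end all runners are half-lines
  with the charges of \<open>\<kappa>\<close>, so the diagrams coincide. The charge \<open>c\<close>
  is left open because a diagram assembled from runners has a charge not known in advance;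
  \<open>c = 0\<close> is part of the result.\<close>

lemma reaches_core:
  assumes "is_core m \<kappa>" "0 < m" "is_partition \<mu>"
    and "\<forall>r<m. charge (runner m r (beads c \<mu>)) = charge (runner m r (beads 0 \<kappa>))"
  shows "c = 0 \<and> (removes_rim_hook m)\<^sup>*\<^sup>* \<mu> \<kappa>"
  using assms(3,4)
proof (induction "psize \<mu>" arbitrary: \<mu> rule: less_induct)
  case less
  have \<kappa>: "is_partition \<kappa>" using assms(1) by (simp add: is_core_def)
  show ?case
  proof (cases "\<forall>x\<in>beads c \<mu>. x - int m \<in> beads c \<mu>")
    case True
    have "beads c \<mu> = beads 0 \<kappa>"
    proof (rule runners_eqI[OF assms(2)])
      fix r assume "r < m"
      moreover have "runner m r (beads c \<mu>) = {..<charge (runner m r (beads c \<mu>))}"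
        by (rule runner_closed) (use assms(2) less.prems True in \<open>auto simp: maya_beads\<close>)
      moreover have "runner m r (beads 0 \<kappa>) = {..<charge (runner m r (beads 0 \<kappa>))}"
        by (rule runner_closed) (use assms(2) \<kappa> core_beads_closed[OF assms(1)] in \<open>auto simp: maya_beads\<close>)
      ultimately show "runner m r (beads c \<mu>) = runner m r (beads 0 \<kappa>)"
        using less.prems(2) by simp
    qed
    then show ?thesis using beads_unique[OF less.prems(1) \<kappa>] by blast
  next
    case False
    then obtain x where "x \<in> beads c \<mu>" "x - int m \<notin> beads c \<mu>" by blast
    then obtain \<nu> i k where rows: "rim_hook_rows m \<mu> \<nu> i k"
      using bead_move[OF less.prems(1)] by blast
    have "c = 0 \<and> (removes_rim_hook m)\<^sup>*\<^sup>* \<nu> \<kappa>"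
    proof (rule less.hyps)
      show "psize \<nu> < psize \<mu>"
        using rim_hook_rows_psize[OF less.prems(1) rows] assms(2) by simp
      show "is_partition \<nu>" by (rule rim_hook_rows_partition[OF less.prems(1) rows])
      show "\<forall>r<m. charge (runner m r (beads c \<nu>)) = charge (runner m r (beads 0 \<kappa>))"
        using rim_hook_rows_runners(1)[OF less.prems(1) rows assms(2)] less.prems(2) by simp
    qed
    then show ?thesis
      using rim_hook_rows_removes[OF less.prems(1) rows] by (meson converse_rtranclp_into_rtranclp)
  qed
qed

text \<open>Replaces the relational definition of the core by the charges of the runners: they are
  invariant under removals, and by \<open>reaches_core\<close> they determine the outcome.\<close>

lemma partitions_with_core_iff:
  assumes "is_core m \<kappa>" "0 < m"
  shows "\<mu> \<in> partitions_with_core m \<kappa> \<longleftrightarrow> is_partition \<mu> \<and>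
    (\<forall>r<m. charge (runner m r (beads 0 \<mu>)) = charge (runner m r (beads 0 \<kappa>)))"
proof
  assume "\<mu> \<in> partitions_with_core m \<kappa>"
  then show "is_partition \<mu> \<and>
    (\<forall>r<m. charge (runner m r (beads 0 \<mu>)) = charge (runner m r (beads 0 \<kappa>)))"
    using rtranclp_removes_runners[of m \<mu> \<kappa> 0] assms(2)
    by (simp add: partitions_with_core_def has_core_def)
next
  assume "is_partition \<mu> \<and>
    (\<forall>r<m. charge (runner m r (beads 0 \<mu>)) = charge (runner m r (beads 0 \<kappa>)))"
  then show "\<mu> \<in> partitions_with_core m \<kappa>"
    using reaches_core[OF assms, of \<mu> 0] removes_rim_hook_rows[OF _ assms(2)] core_no_rim_hook_rows[OF assms(1)]
    unfolding partitions_with_core_def has_core_def by blast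
qed

text \<open>The restriction to indices below \<open>m\<close> places the tuple in the extensional
  function space \<open>PiE\<close>.\<close>

definition core_quotient :: "nat \<Rightarrow> (nat \<Rightarrow> nat) \<Rightarrow> nat \<Rightarrow> nat \<Rightarrow> nat" where
  "core_quotient m \<mu> = restrict (\<lambda>r. shape (runner m r (beads 0 \<mu>))) {..<m}"

text \<open>A fixed core fixes the charges of all runners, so a partition in the fibre is determined
  by the shapes of its runners, and these can be prescribed independently.\<close>

lemma bij_betw_quotient:
  assumes "is_core m \<kappa>" "0 < m"
  shows "bij_betw (core_quotient m) (partitions_with_core m \<kappa>) (PiE {..<m} (\<lambda>_. Collect is_partition))"
proof (rule bij_betw_imageI)
  have coords: "is_partition (shape (runner m r (beads 0 \<mu>)))"
    "beads (charge (runner m r (beads 0 \<mu>))) (shape (runner m r (beads 0 \<mu>))) = runner m r (beads 0 \<mu>)"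
    if "is_partition \<mu>" for \<mu> r
    using maya_coords[OF maya_runner[OF assms(2) maya_beads[OF that]]] by auto
  show "inj_on (core_quotient m) (partitions_with_core m \<kappa>)"
  proof (rule inj_onI)
    fix \<mu> \<nu> assume \<mu>: "\<mu> \<in> partitions_with_core m \<kappa>" and \<nu>: "\<nu> \<in> partitions_with_core m \<kappa>"
      and eq: "core_quotient m \<mu> = core_quotient m \<nu>"
    note iff = partitions_with_core_iff[OF assms]
    have part: "is_partition \<mu>" "is_partition \<nu>" using \<mu> \<nu> iff by auto
    have "beads 0 \<mu> = beads 0 \<nu>"
    proof (rule runners_eqI[OF assms(2)])
      fix r assume r: "r < m"
      have "core_quotient m \<mu> r = core_quotient m \<nu> r" using eq by simp
      then have "shape (runner m r (beads 0 \<mu>)) = shape (runner m r (beads 0 \<nu>))"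
        using r by (simp add: core_quotient_def)
      moreover have "charge (runner m r (beads 0 \<mu>)) = charge (runner m r (beads 0 \<nu>))"
        using \<mu> \<nu> r iff by auto
      ultimately show "runner m r (beads 0 \<mu>) = runner m r (beads 0 \<nu>)"
        using coords(2)[OF part(1), of r] coords(2)[OF part(2), of r] by metis
    qed
    then show "\<mu> = \<nu>" using beads_unique(2)[OF part] by blast
  qed
  show "core_quotient m ` partitions_with_core m \<kappa> = PiE {..<m} (\<lambda>_. Collect is_partition)"
  proof (intro equalityI subsetI)
    fix \<rho> assume "\<rho> \<in> core_quotient m ` partitions_with_core m \<kappa>"
    then show "\<rho> \<in> PiE {..<m} (\<lambda>_. Collect is_partition)"
      using coords(1) partitions_with_core_iff[OF assms] by (auto simp: core_quotient_def)
  next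
    fix \<rho> assume \<rho>: "\<rho> \<in> PiE {..<m} (\<lambda>_. Collect is_partition)"
    define C where "C = (\<lambda>r. charge (runner m r (beads 0 \<kappa>)))"
    \<comment> \<open>The given partitions, at the charges of \<open>\<kappa>\<close>, are
      interleaved into one set of beads.\<close>
    define S where "S = {x. x div int m \<in> beads (C (nat (x mod int m))) (\<rho> (nat (x mod int m)))}"
    have S: "runner m r S = beads (C r) (\<rho> r)" if "r < m" for r
      using that by (auto simp: runner_def S_def)
    have \<rho>_part: "is_partition (\<rho> r)" if "r < m" for r using \<rho> that by auto
    have "maya S"
      by (rule maya_of_runners[OF assms(2)]) (simp add: S maya_beads \<rho>_part)
    then obtain c \<mu> where \<mu>: "is_partition \<mu>" "S = beads c \<mu>" using maya_exists by blast
    have ch: "\<forall>r<m. charge (runner m r (beads c \<mu>)) = charge (runner m r (beads 0 \<kappa>))"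
      using S charge_beads[OF \<rho>_part] by (simp add: \<mu>(2)[symmetric] C_def)
    then have "c = 0" using reaches_core[OF assms \<mu>(1)] by blast
    have "\<mu> \<in> partitions_with_core m \<kappa>"
      using partitions_with_core_iff[OF assms] \<mu>(1) ch \<open>c = 0\<close> by simp
    moreover have "core_quotient m \<mu> = \<rho>"
    proof
      fix r
      show "core_quotient m \<mu> r = \<rho> r"
      proof (cases "r < m")
        case True
        have "runner m r (beads 0 \<mu>) = beads (C r) (\<rho> r)"
          using S[OF True] \<mu>(2) \<open>c = 0\<close> by simp
        then show ?thesis
          using True shape_beads[OF \<rho>_part[OF True]] by (simp add: core_quotient_def)
      next
        case False
        then show ?thesis using PiE_arb[OF \<rho>, of r] by (simp add: core_quotient_def)
      qed
    qed
    ultimately show "\<rho> \<in> core_quotient m ` partitions_with_core m \<kappa>" by blast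
  qed
qed

lemma psize_quotient:
  assumes "is_core m \<kappa>" "0 < m" "\<mu> \<in> partitions_with_core m \<kappa>"
  shows "psize \<mu> = psize \<kappa> + m * (\<Sum>r<m. psize (core_quotient m \<mu> r))"
proof -
  have "(removes_rim_hook m)\<^sup>*\<^sup>* \<mu> \<kappa>"
    using assms(3) by (simp add: partitions_with_core_def has_core_def)
  then show ?thesis
    using rtranclp_removes_runners[of m \<mu> \<kappa> 0] core_quotient_size[OF assms(1,2), of 0] assms(2)
    by (simp add: quotient_size_def core_quotient_def)
qed

section \<open>Generating functions of partitions\<close>

lemma graded_le:
  assumes "graded A w" "\<And>a. a \<in> A \<Longrightarrow> w a \<le> v a"
  shows "graded A v"
  unfolding graded_def
proof
  fix n
  have "{a \<in> A. v a = n} \<subseteq> (\<Union>k\<le>n. {a \<in> A. w a = k})" using assms(2) by auto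
  moreover have "finite (\<Union>k\<le>n. {a \<in> A. w a = k})" using gradedD[OF assms(1)] by auto
  ultimately show "finite {a \<in> A. v a = n}" by (rule finite_subset)
qed

lemma partition_entry_le_psize:
  assumes "is_partition \<mu>"
  shows "\<mu> i \<le> psize \<mu>"
proof (cases "\<mu> i = 0")
  case False
  then show ?thesis
    unfolding psize_def using assms by (intro member_le_sum) (auto simp: is_partition_def)
qed simp

text \<open>Otherwise the \<open>n + 1\<close> parts of index 0 to \<open>n\<close> are all at least
  1. This bounds the number of parts by the size.\<close>

lemma partition_length_le_psize:
  assumes "is_partition \<mu>" "psize \<mu> \<le> n"
  shows "\<mu> n = 0"
proof (rule ccontr)
  assume n: "\<mu> n \<noteq> 0"
  obtain N where N: "\<And>i. N \<le> i \<Longrightarrow> \<mu> i = 0" using partition_support[OF assms(1)] by blast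
  have "Suc n \<le> N" using N[of n] n not_less_eq_eq by blast
  have "(\<Sum>i<Suc n. 1) \<le> (\<Sum>i<Suc n. \<mu> i)"
  proof (rule sum_mono)
    fix i assume "i \<in> {..<Suc n}"
    then show "1 \<le> \<mu> i" using partition_antimono[OF assms(1), of i n] n by simp
  qed
  also have "\<dots> \<le> (\<Sum>i<N. \<mu> i)" using \<open>Suc n \<le> N\<close> by (intro sum_mono2) auto
  also have "\<dots> = psize \<mu>" using psize_eq_sum[of N \<mu>] N by simp
  finally show False using assms(2) by simp
qed

lemma graded_partitions: "graded (Collect is_partition) psize"
  unfolding graded_def
proof
  fix n
  \<comment> \<open>A partition of \<open>n\<close> has at most \<open>n\<close> nonzero parts, each
    at most \<open>n\<close>.\<close>
  have "{\<mu> \<in> Collect is_partition. psize \<mu> = n} \<subseteq>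
      {\<mu>. \<forall>i. (i \<in> {..<n} \<longrightarrow> \<mu> i \<in> {..n}) \<and> (i \<notin> {..<n} \<longrightarrow> \<mu> i = 0)}"
    by (auto simp: partition_entry_le_psize partition_length_le_psize)
  then show "finite {\<mu> \<in> Collect is_partition. psize \<mu> = n}"
    by (rule finite_subset) (rule finite_set_of_finite_funs; simp)
qed

lemma graded_scaled_partitions: "0 < m \<Longrightarrow> graded (Collect is_partition) (\<lambda>\<rho>. m * psize \<rho>)"
  by (rule graded_le[OF graded_partitions]) simp

section \<open>Euler's product for partitions by size and largest part\<close>

definition short_partitions :: "nat \<Rightarrow> (nat \<Rightarrow> nat) set" where
  "short_partitions N = {\<rho>. is_partition \<rho> \<and> \<rho> N = 0}"

lemma short_partition_zero: "\<rho> \<in> short_partitions N \<Longrightarrow> N \<le> j \<Longrightarrow> \<rho> j = 0"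
  using partition_antimono[of \<rho> N j] by (simp add: short_partitions_def)

text \<open>The bijection inserts a column of length \<open>N + 1\<close>.\<close>

lemma short_partitions_Suc:
  "bij_betw (\<lambda>\<rho> j. if j \<le> N then Suc (\<rho> j) else \<rho> j) (short_partitions (Suc N))
     {\<rho> \<in> short_partitions (Suc N). \<rho> N \<noteq> 0}"
proof (rule bij_betw_byWitness[where f' = "\<lambda>\<sigma> j. \<sigma> j - 1"])
  show "\<forall>\<rho>\<in>short_partitions (Suc N). (\<lambda>j. (if j \<le> N then Suc (\<rho> j) else \<rho> j) - 1) = \<rho>"
    by (auto simp: fun_eq_iff short_partition_zero)
  show "\<forall>\<sigma>\<in>{\<rho> \<in> short_partitions (Suc N). \<rho> N \<noteq> 0}.
      (\<lambda>j. if j \<le> N then Suc (\<sigma> j - 1) else \<sigma> j - 1) = \<sigma>"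
  proof (intro ballI ext)
    fix \<sigma> j assume \<sigma>: "\<sigma> \<in> {\<rho> \<in> short_partitions (Suc N). \<rho> N \<noteq> 0}"
    then have "j \<le> N \<Longrightarrow> \<sigma> N \<le> \<sigma> j" using partition_antimono by (auto simp: short_partitions_def)
    then show "(if j \<le> N then Suc (\<sigma> j - 1) else \<sigma> j - 1) = \<sigma> j"
      using \<sigma> short_partition_zero[of \<sigma> "Suc N" j] by auto
  qed
  show "(\<lambda>\<rho> j. if j \<le> N then Suc (\<rho> j) else \<rho> j) ` short_partitions (Suc N)
      \<subseteq> {\<rho> \<in> short_partitions (Suc N). \<rho> N \<noteq> 0}"
  proof safe
    fix \<rho> assume \<rho>: "\<rho> \<in> short_partitions (Suc N)"
    have "is_partition (\<lambda>j. if j \<le> N then Suc (\<rho> j) else \<rho> j)"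
    proof (rule is_partitionI)
      fix j
      show "(if Suc j \<le> N then Suc (\<rho> (Suc j)) else \<rho> (Suc j)) \<le> (if j \<le> N then Suc (\<rho> j) else \<rho> j)"
        using \<rho> partition_antimono[of \<rho> j "Suc j"] by (auto simp: short_partitions_def)
    next
      fix j assume "Suc N \<le> j"
      then show "(if j \<le> N then Suc (\<rho> j) else \<rho> j) = 0" using \<rho> by (simp add: short_partition_zero)
    qed
    then show "(\<lambda>j. if j \<le> N then Suc (\<rho> j) else \<rho> j) \<in> short_partitions (Suc N)"
      using \<rho> by (simp add: short_partitions_def)
  qed simp
  show "(\<lambda>\<sigma> j. \<sigma> j - 1) ` {\<rho> \<in> short_partitions (Suc N). \<rho> N \<noteq> 0} \<subseteq> short_partitions (Suc N)"
  proof safe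
    fix \<sigma> assume \<sigma>: "\<sigma> \<in> short_partitions (Suc N)"
    have "is_partition (\<lambda>j. \<sigma> j - 1)"
    proof (rule is_partitionI)
      show "\<sigma> (Suc j) - 1 \<le> \<sigma> j - 1" for j
        using \<sigma> partition_antimono[of \<sigma> j "Suc j"] by (simp add: short_partitions_def diff_le_mono)
      show "\<sigma> j - 1 = 0" if "Suc N \<le> j" for j
        using short_partition_zero[OF \<sigma> that] by simp
    qed
    then show "(\<lambda>j. \<sigma> j - 1) \<in> short_partitions (Suc N)"
      using \<sigma> by (simp add: short_partitions_def)
  qed
qed

text \<open>A partition with at most \<open>N + 1\<close> parts either has at most \<open>N\<close>
  parts or arises by inserting a column of length \<open>N + 1\<close>. The insertion contributes
  \<open>t * q ^ (m * (N + 1))\<close>, as t marks the largest part, which is the number of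
  columns.\<close>

lemma gf_short_partitions:
  fixes t :: "'a::comm_ring_1"
  assumes "0 < m"
  shows "gf (short_partitions N) (\<lambda>\<rho>. m * psize \<rho>) (\<lambda>\<rho>. t ^ \<rho> 0)
    * (\<Prod>i<N. 1 - fps_const t * fps_X ^ (m * (i + 1))) = 1"
proof (induction N)
  case 0
  have "short_partitions 0 = {\<lambda>_. 0}"
    using short_partition_zero[of _ 0] is_partition_zero by (fastforce simp: short_partitions_def)
  then show ?case by (simp add: gf_singleton psize_def)
next
  case (Suc N)
  define G where "G N = gf (short_partitions N) (\<lambda>\<rho>. m * psize \<rho>) (\<lambda>\<rho>. t ^ \<rho> 0)" for N
  define \<phi> where "\<phi> = (\<lambda>(\<rho> :: nat \<Rightarrow> nat) j. if j \<le> N then Suc (\<rho> j) else \<rho> j)"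
  have graded: "graded A (\<lambda>\<rho>. m * psize \<rho>)" if "A \<subseteq> short_partitions (Suc N)" for A
    by (rule graded_subset[OF graded_scaled_partitions[OF assms]])
      (use that in \<open>auto simp: short_partitions_def\<close>)
  have sub: "short_partitions N \<subseteq> short_partitions (Suc N)"
    using short_partition_zero[of _ N "Suc N"] by (auto simp: short_partitions_def)
  then have split: "short_partitions (Suc N) = short_partitions N \<union> {\<rho> \<in> short_partitions (Suc N). \<rho> N \<noteq> 0}"
    by (auto simp: short_partitions_def)
  have "gf {\<rho> \<in> short_partitions (Suc N). \<rho> N \<noteq> 0} (\<lambda>\<rho>. m * psize \<rho>) (\<lambda>\<rho>. t ^ \<rho> 0)
      = gf (short_partitions (Suc N)) (\<lambda>\<rho>. m * Suc N + m * psize \<rho>) (\<lambda>\<rho>. t * t ^ \<rho> 0)"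
  proof (rule gf_bij[symmetric])
    show "bij_betw \<phi> (short_partitions (Suc N)) {\<rho> \<in> short_partitions (Suc N). \<rho> N \<noteq> 0}"
      unfolding \<phi>_def by (rule short_partitions_Suc)
    fix \<rho> assume \<rho>: "\<rho> \<in> short_partitions (Suc N)"
    have "psize (\<phi> \<rho>) = (\<Sum>j<Suc N. \<phi> \<rho> j)"
      by (rule psize_eq_sum) (use short_partition_zero[OF \<rho>] in \<open>auto simp: \<phi>_def\<close>)
    also have "\<dots> = (\<Sum>j<Suc N. Suc (\<rho> j))" by (rule sum.cong) (auto simp: \<phi>_def)
    also have "\<dots> = Suc N + (\<Sum>j<Suc N. \<rho> j)" by (simp only: Suc_eq_plus1_left sum.distrib) simp
    also have "(\<Sum>j<Suc N. \<rho> j) = psize \<rho>"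
      by (rule psize_eq_sum[symmetric]) (rule short_partition_zero[OF \<rho>])
    finally show "m * Suc N + m * psize \<rho> = m * psize (\<phi> \<rho>)" by (simp add: distrib_left)
    show "t * t ^ \<rho> 0 = t ^ \<phi> \<rho> 0" by (simp add: \<phi>_def)
  qed
  then have "gf {\<rho> \<in> short_partitions (Suc N). \<rho> N \<noteq> 0} (\<lambda>\<rho>. m * psize \<rho>) (\<lambda>\<rho>. t ^ \<rho> 0)
      = fps_const t * fps_X ^ (m * Suc N) * G (Suc N)"
    unfolding gf_shift G_def .
  moreover have "G (Suc N) = G N + gf {\<rho> \<in> short_partitions (Suc N). \<rho> N \<noteq> 0} (\<lambda>\<rho>. m * psize \<rho>) (\<lambda>\<rho>. t ^ \<rho> 0)"
    unfolding G_def
    by (subst split, rule gf_Un_disjoint[OF graded graded])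
      (use sub in \<open>auto simp: short_partitions_def\<close>)
  \<comment> \<open>Solving this recurrence for \<open>G (Suc N)\<close> produces the new factor of
    the product.\<close>
  ultimately have "G (Suc N) = G N + fps_const t * fps_X ^ (m * Suc N) * G (Suc N)" by simp
  then have "G (Suc N) * (1 - fps_const t * fps_X ^ (m * (N + 1))) = G N"
    by (simp add: algebra_simps)
  then have "G (Suc N) * (\<Prod>i<Suc N. 1 - fps_const t * fps_X ^ (m * (i + 1)))
      = G N * (\<Prod>i<N. 1 - fps_const t * fps_X ^ (m * (i + 1)))"
    unfolding prod.lessThan_Suc
      mult.commute[of "\<Prod>i<N. 1 - fps_const t * fps_X ^ (m * (i + 1))"] mult.assoc[symmetric]
    by simp
  then show ?case using Suc.IH by (simp only: G_def)
qed

text \<open>Up to degree \<open>n\<close> only partitions with at most \<open>n\<close> parts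
  contribute, so the finite product formula applies.\<close>

lemma gf_partitions:
  fixes t :: "'a::comm_ring_1"
  assumes "0 < m"
  shows "eq_upto n (gf (Collect is_partition) (\<lambda>\<rho>. m * psize \<rho>) (\<lambda>\<rho>. t ^ \<rho> 0)
    * (\<Prod>i<n. 1 - fps_const t * fps_X ^ (m * (i + 1)))) 1"
proof -
  have "eq_upto n (gf (Collect is_partition) (\<lambda>\<rho>. m * psize \<rho>) (\<lambda>\<rho>. t ^ \<rho> 0))
      (gf (short_partitions n) (\<lambda>\<rho>. m * psize \<rho>) (\<lambda>\<rho>. t ^ \<rho> 0))"
    unfolding eq_upto_def gf_nth
  proof (intro allI impI sum.cong refl)
    fix k assume "k \<le> n"
    have "\<rho> n = 0" if "is_partition \<rho>" "m * psize \<rho> = k" for \<rho>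
    proof (rule partition_length_le_psize[OF that(1)])
      have "1 * psize \<rho> \<le> m * psize \<rho>" using assms by (intro mult_right_mono) auto
      then show "psize \<rho> \<le> n" using that(2) \<open>k \<le> n\<close> by simp
    qed
    then show "{\<rho> \<in> Collect is_partition. m * psize \<rho> = k} = {\<rho> \<in> short_partitions n. m * psize \<rho> = k}"
      by (auto simp: short_partitions_def)
  qed
  from eq_upto_mult[OF this eq_upto_refl[of n "\<Prod>i<n. 1 - fps_const t * fps_X ^ (m * (i + 1))"]]
  show ?thesis
    unfolding gf_short_partitions[OF assms] .
qed

section \<open>Restricted partitions\<close>

definition add_scaled :: "nat \<Rightarrow> (nat \<Rightarrow> nat) \<Rightarrow> (nat \<Rightarrow> nat) \<Rightarrow> nat \<Rightarrow> nat" where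
  "add_scaled m \<nu> \<rho> i = \<nu> i + m * \<rho> i"

lemma add_scaled_partition:
  assumes "is_partition \<nu>" "is_partition \<rho>"
  shows "is_partition (add_scaled m \<nu> \<rho>)" "psize (add_scaled m \<nu> \<rho>) = psize \<nu> + m * psize \<rho>"
proof -
  obtain M where M: "\<And>i. M \<le> i \<Longrightarrow> \<nu> i = 0" using partition_support[OF assms(1)] by blast
  obtain N where N: "\<And>i. N \<le> i \<Longrightarrow> \<rho> i = 0" using partition_support[OF assms(2)] by blast
  note MN = M N
  show "is_partition (add_scaled m \<nu> \<rho>)"
  proof (rule is_partitionI)
    show "add_scaled m \<nu> \<rho> (Suc i) \<le> add_scaled m \<nu> \<rho> i" for i
      using partition_antimono[OF assms(1), of i "Suc i"] partition_antimono[OF assms(2), of i "Suc i"]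
      by (simp add: add_scaled_def add_mono)
    show "add_scaled m \<nu> \<rho> i = 0" if "max M N \<le> i" for i
      using that by (simp add: add_scaled_def MN)
  qed
  have "psize (add_scaled m \<nu> \<rho>) = (\<Sum>i<max M N. add_scaled m \<nu> \<rho> i)"
    by (rule psize_eq_sum) (simp add: add_scaled_def MN)
  also have "\<dots> = (\<Sum>i<max M N. \<nu> i) + m * (\<Sum>i<max M N. \<rho> i)"
    by (simp add: add_scaled_def sum.distrib sum_distrib_left)
  also have "(\<Sum>i<max M N. \<nu> i) = psize \<nu>"
    by (rule psize_eq_sum[symmetric]) (simp add: MN)
  also have "(\<Sum>i<max M N. \<rho> i) = psize \<rho>"
    by (rule psize_eq_sum[symmetric]) (simp add: MN)
  finally show "psize (add_scaled m \<nu> \<rho>) = psize \<nu> + m * psize \<rho>" .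
qed

text \<open>
  Lowering the last nonzero part of \<open>\<rho>\<close> by one removes a horizontal strip of \<open>m\<close> cells.
\<close>

lemma add_scaled_reaches:
  assumes "is_partition \<nu>" "is_partition \<rho>" "0 < m"
  shows "(removes_rim_hook m)\<^sup>*\<^sup>* (add_scaled m \<nu> \<rho>) \<nu>"
  using assms(2)
proof (induction "psize \<rho>" arbitrary: \<rho> rule: less_induct)
  case less
  show ?case
  proof (cases "\<rho> 0 = 0")
    case True
    then have "\<rho> i = 0" for i using partition_antimono[OF less.prems, of 0 i] by simp
    then have "add_scaled m \<nu> \<rho> = \<nu>" by (simp add: add_scaled_def fun_eq_iff)
    then show ?thesis by simp
  next
    case False
    obtain N where "\<And>i. N \<le> i \<Longrightarrow> \<rho> i = 0" using partition_support[OF less.prems] by blast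
    then have "\<rho> N = 0" by simp
    then obtain k where k: "\<rho> k \<noteq> 0" "\<rho> (Suc k) = 0" using False
      by (induction N) (simp, metis)
    define \<rho>' where "\<rho>' = \<rho>(k := \<rho> k - 1)"
    have rows: "rim_hook_rows 1 \<rho> \<rho>' k k"
      using k by (auto simp: rim_hook_rows_def \<rho>'_def)
    have "\<nu> (Suc k) \<le> \<nu> k" using assms(1) by (simp add: partition_antimono)
    moreover have "m * \<rho> k = m * (\<rho> k - 1) + m" using k by (cases "\<rho> k") auto
    ultimately have step: "rim_hook_rows m (add_scaled m \<nu> \<rho>) (add_scaled m \<nu> \<rho>') k k"
      using k assms(3) by (auto simp: rim_hook_rows_def \<rho>'_def add_scaled_def)
    have \<rho>': "is_partition \<rho>'" "psize \<rho>' < psize \<rho>"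
      using rim_hook_rows_partition[OF less.prems rows] rim_hook_rows_psize[OF less.prems rows] by auto
    have "removes_rim_hook m (add_scaled m \<nu> \<rho>) (add_scaled m \<nu> \<rho>')"
      by (rule rim_hook_rows_removes[OF add_scaled_partition(1)[OF assms(1) less.prems] step])
    then show ?thesis
      using less.hyps[OF \<rho>'(2,1)] by (rule converse_rtranclp_into_rtranclp)
  qed
qed

text \<open>Consecutive differences of \<open>\<nu>\<close> are below \<open>m\<close>, so division
  with remainder recovers those of \<open>\<rho>\<close> from the differences of the sum. Then
  \<open>\<rho>\<close> follows by descending from indices where it vanishes.\<close>

lemma add_scaled_inj:
  assumes "is_partition \<nu>" "is_partition \<rho>" "is_partition \<nu>'" "is_partition \<rho>'"
    and "\<nu> \<in> restricted_partitions m" "\<nu>' \<in> restricted_partitions m"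
    and eq: "add_scaled m \<nu> \<rho> = add_scaled m \<nu>' \<rho>'"
  shows "\<nu> = \<nu>' \<and> \<rho> = \<rho>'"
proof -
  have m: "0 < m" using assms(5) by (auto simp: restricted_partitions_def)
  have eq_i: "\<nu> i + m * \<rho> i = \<nu>' i + m * \<rho>' i" for i
    using fun_cong[OF eq, of i] by (simp add: add_scaled_def)
  have diff: "\<rho> i - \<rho> (Suc i) = ((\<nu> i + m * \<rho> i) - (\<nu> (Suc i) + m * \<rho> (Suc i))) div m"
    if part: "is_partition \<nu>" "is_partition \<rho>" and res: "\<nu> \<in> restricted_partitions m" for \<nu> \<rho> i
  proof -
    obtain a where a: "\<nu> i = \<nu> (Suc i) + a"
      using partition_antimono[OF part(1), of i "Suc i"] le_Suc_ex by auto
    obtain b where b: "\<rho> i = \<rho> (Suc i) + b"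
      using partition_antimono[OF part(2), of i "Suc i"] le_Suc_ex by auto
    have "a < m" using res a spec[of "\<lambda>i. \<nu> i - \<nu> (Suc i) < m" i] by (simp add: restricted_partitions_def)
    then show ?thesis by (simp add: a b distrib_left)
  qed
  have down: "\<rho> i = \<rho>' i" if "\<rho> (Suc i) = \<rho>' (Suc i)" for i
    using diff[OF assms(1,2,5), of i] diff[OF assms(3,4,6), of i] eq_i[of i] eq_i[of "Suc i"] that
      partition_antimono[OF assms(2), of i "Suc i"] partition_antimono[OF assms(4), of i "Suc i"]
    by simp
  obtain M where M: "\<And>i. M \<le> i \<Longrightarrow> \<rho> i = 0" using partition_support[OF assms(2)] by blast
  obtain N where N: "\<And>i. N \<le> i \<Longrightarrow> \<rho>' i = 0" using partition_support[OF assms(4)] by blast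
  note MN = M N
  have "\<rho> i = \<rho>' i" for i
  proof (cases "i \<le> max M N")
    case True
    then show ?thesis
    proof (induction rule: inc_induct)
      case base
      then show ?case by (simp add: MN)
    next
      case (step j)
      then show ?case using down by blast
    qed
  qed (simp add: MN)
  then show ?thesis using eq_i by (auto simp: fun_eq_iff)
qed

lemma add_scaled_exists:
  assumes "is_partition \<mu>" "0 < m"
  shows "\<exists>\<nu> \<rho>. \<nu> \<in> restricted_partitions m \<and> is_partition \<rho> \<and> \<mu> = add_scaled m \<nu> \<rho>"
  using assms(1)
proof (induction "psize \<mu>" arbitrary: \<mu> rule: less_induct)
  case less
  show ?case
  proof (cases "\<forall>i. \<mu> i - \<mu> (Suc i) < m")
    case True
    then have "\<mu> \<in> restricted_partitions m" using less.prems by (simp add: restricted_partitions_def)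
    moreover have "\<mu> = add_scaled m \<mu> (\<lambda>_. 0)" by (simp add: add_scaled_def fun_eq_iff)
    ultimately show ?thesis using is_partition_zero by blast
  next
    case False
    then obtain k where "m \<le> \<mu> k - \<mu> (Suc k)" by (auto simp: not_less)
    then have k: "\<mu> (Suc k) + m \<le> \<mu> k" using assms(2) by simp
    \<comment> \<open>As long as a difference at \<open>k\<close> is at least \<open>m\<close>, one
      can take away \<open>m\<close> columns of length \<open>k + 1\<close>; this lowers the first
      \<open>k + 1\<close> parts of \<open>\<rho>\<close> by one.\<close>
    define \<mu>' where "\<mu>' = (\<lambda>j. if j \<le> k then \<mu> j - m else \<mu> j)"
    obtain N where N: "\<And>i. N \<le> i \<Longrightarrow> \<mu> i = 0" using partition_support[OF less.prems] by blast
    have le: "m \<le> \<mu> j" if "j \<le> k" for j using partition_antimono[OF less.prems that] k by simp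
    have part': "is_partition \<mu>'"
    proof (rule is_partitionI)
      show "\<mu>' (Suc j) \<le> \<mu>' j" for j
        using partition_antimono[OF less.prems, of j "Suc j"] k le[of j]
        by (cases "j = k") (auto simp: \<mu>'_def)
      show "\<mu>' j = 0" if "N \<le> j" for j using N[OF that] by (simp add: \<mu>'_def)
    qed
    have "k < N" using k N[of k] assms(2) by (cases "k < N") auto
    have "psize \<mu>' = (\<Sum>j<N. \<mu>' j)" by (rule psize_eq_sum) (simp add: \<mu>'_def N)
    also have "\<dots> < (\<Sum>j<N. \<mu> j)"
      by (rule sum_strict_mono_ex1) (use \<open>k < N\<close> le[of k] assms(2) in \<open>auto simp: \<mu>'_def intro!: bexI[of _ k]\<close>)
    also have "\<dots> = psize \<mu>" by (rule psize_eq_sum[symmetric]) (simp add: N)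
    finally obtain \<nu> \<rho> where IH: "\<nu> \<in> restricted_partitions m" "is_partition \<rho>" "\<mu>' = add_scaled m \<nu> \<rho>"
      using less.hyps part' by blast
    define \<rho>' where "\<rho>' = (\<lambda>j. if j \<le> k then Suc (\<rho> j) else \<rho> j)"
    obtain M where M: "\<And>i. M \<le> i \<Longrightarrow> \<rho> i = 0" using partition_support[OF IH(2)] by blast
    have "is_partition \<rho>'"
    proof (rule is_partitionI)
      show "\<rho>' (Suc j) \<le> \<rho>' j" for j
        using partition_antimono[OF IH(2), of j "Suc j"] by (auto simp: \<rho>'_def)
      show "\<rho>' j = 0" if "max M (Suc k) \<le> j" for j using M that by (simp add: \<rho>'_def)
    qed
    moreover have "\<mu> = add_scaled m \<nu> \<rho>'"
    proof
      fix j
      show "\<mu> j = add_scaled m \<nu> \<rho>' j"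
        using fun_cong[OF IH(3), of j] le[of j] by (auto simp: \<mu>'_def \<rho>'_def add_scaled_def)
    qed
    ultimately show ?thesis using IH(1) by blast
  qed
qed

lemma bij_betw_add_scaled:
  assumes "is_core m \<kappa>" "0 < m"
  shows "bij_betw (\<lambda>(\<nu>, \<rho>). add_scaled m \<nu> \<rho>)
    ((partitions_with_core m \<kappa> \<inter> restricted_partitions m) \<times> Collect is_partition)
    (partitions_with_core m \<kappa>)"
proof -
  \<comment> \<open>Since \<open>\<nu>\<close> is reached by rim hook removals, it has the same
    runner charges as the sum.\<close>
  have same: "add_scaled m \<nu> \<rho> \<in> partitions_with_core m \<kappa> \<longleftrightarrow> \<nu> \<in> partitions_with_core m \<kappa>"
    if "is_partition \<nu>" "is_partition \<rho>" for \<nu> \<rho>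
    using rtranclp_removes_runners[OF add_scaled_reaches[OF that assms(2)] assms(2), of 0] that
      add_scaled_partition(1)[OF that, of m] by (simp add: partitions_with_core_iff[OF assms])
  have part: "is_partition \<nu>" if "\<nu> \<in> restricted_partitions m" for \<nu>
    using that by (simp add: restricted_partitions_def)
  show ?thesis
  proof (rule bij_betw_imageI)
    show "inj_on (\<lambda>(\<nu>, \<rho>). add_scaled m \<nu> \<rho>)
        ((partitions_with_core m \<kappa> \<inter> restricted_partitions m) \<times> Collect is_partition)"
    proof (rule inj_onI, clarify)
      fix \<nu> \<rho> \<nu>' \<rho>'
      assume "is_partition \<rho>" "is_partition \<rho>'" "\<nu> \<in> restricted_partitions m" "\<nu>' \<in> restricted_partitions m"
        "add_scaled m \<nu> \<rho> = add_scaled m \<nu>' \<rho>'"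
      then show "\<nu> = \<nu>' \<and> \<rho> = \<rho>'" using add_scaled_inj part by blast
    qed
    show "(\<lambda>(\<nu>, \<rho>). add_scaled m \<nu> \<rho>) ` ((partitions_with_core m \<kappa> \<inter> restricted_partitions m)
        \<times> Collect is_partition) = partitions_with_core m \<kappa>"
    proof (intro equalityI subsetI)
      fix \<mu> assume \<mu>: "\<mu> \<in> partitions_with_core m \<kappa>"
      then have "is_partition \<mu>" by (simp add: partitions_with_core_def)
      then obtain \<nu> \<rho> where *: "\<nu> \<in> restricted_partitions m" "is_partition \<rho>" "\<mu> = add_scaled m \<nu> \<rho>"
        using add_scaled_exists assms(2) by blast
      then have "\<nu> \<in> partitions_with_core m \<kappa>" using same \<mu> part by blast
      with * show "\<mu> \<in> (\<lambda>(\<nu>, \<rho>). add_scaled m \<nu> \<rho>) ` ((partitions_with_core m \<kappa> \<inter> restricted_partitions m)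
        \<times> Collect is_partition)" by auto
    qed (use same part in auto)
  qed
qed

section \<open>The statistic \<open>h0\<close> of a restricted partition plus a multiple\<close>

lemma leg_eq_0_iff:
  assumes "is_partition \<mu>"
  shows "leg \<mu> (i, j) = 0 \<longleftrightarrow> \<mu> (Suc i) \<le> j"
proof -
  obtain N where N: "\<And>i. N \<le> i \<Longrightarrow> \<mu> i = 0" using partition_support[OF assms] by blast
  \<comment> \<open>An infinite set would also have \<open>card\<close> 0, so finiteness comes
    before reading off emptiness.\<close>
  have "{r. i < r \<and> j < \<mu> r} \<subseteq> {..<N}" using N by (metis (mono_tags, lifting) lessThan_iff mem_Collect_eq not_le not_less_zero subsetI)
  then have "finite {r. i < r \<and> j < \<mu> r}" by (rule finite_subset) simp
  then have "leg \<mu> (i, j) = 0 \<longleftrightarrow> {r. i < r \<and> j < \<mu> r} = {}"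
    by (simp add: leg_def diagram_def)
  also have "\<dots> \<longleftrightarrow> \<mu> (Suc i) \<le> j"
  proof
    assume "{r. i < r \<and> j < \<mu> r} = {}"
    then have "\<not> j < \<mu> (Suc i)" by blast
    then show "\<mu> (Suc i) \<le> j" by simp
  next
    assume "\<mu> (Suc i) \<le> j"
    then have "\<not> j < \<mu> r" if "i < r" for r
      using partition_antimono[OF assms, of "Suc i" r] that by simp
    then show "{r. i < r \<and> j < \<mu> r} = {}" by blast
  qed
  finally show ?thesis .
qed

lemma Suc_arm: "j < \<mu> i \<Longrightarrow> arm \<mu> (i, j) + 1 = \<mu> i - j"
proof -
  assume "j < \<mu> i"
  moreover have "{k. j < k \<and> k < \<mu> i} = {j<..<\<mu> i}" by auto
  ultimately show ?thesis by (simp add: arm_def diagram_def)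
qed

text \<open>Row \<open>i\<close> contains exactly \<open>\<rho> i - \<rho> (Suc i)\<close> of the
  counted cells, and the sum over the rows telescopes.\<close>

lemma h0_add_scaled:
  assumes "\<nu> \<in> restricted_partitions m" "is_partition \<rho>"
  shows "h0 m (add_scaled m \<nu> \<rho>) = \<rho> 0"
proof -
  define \<mu> where "\<mu> = add_scaled m \<nu> \<rho>"
  have \<nu>: "is_partition \<nu>" "\<nu> i - \<nu> (Suc i) < m" for i
    using assms(1) by (auto simp: restricted_partitions_def)
  have m: "0 < m" using \<nu>(2)[of 0] by simp
  have \<mu>: "is_partition \<mu>" "\<mu> i = \<nu> i + m * \<rho> i" for i
    unfolding \<mu>_def using add_scaled_partition[OF \<nu>(1) assms(2)] by (auto simp: add_scaled_def)
  obtain N where N: "\<And>i. N \<le> i \<Longrightarrow> \<rho> i = 0" using partition_support[OF assms(2)] by blast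
  \<comment> \<open>The counted cells of row \<open>i\<close> are those in the columns
    \<open>\<nu> i + m * u\<close> with \<open>\<rho> (Suc i) \<le> u < \<rho> i\<close>.\<close>
  define f where "f = (\<lambda>(i, u). (i :: nat, \<nu> i + m * u))"
  define I where "I = (SIGMA i:{..<N}. {\<rho> (Suc i)..<\<rho> i})"
  have H: "{v \<in> diagram \<mu>. leg \<mu> v = 0 \<and> m dvd arm \<mu> v + 1}
      = {(i, j). j < \<mu> i \<and> \<mu> (Suc i) \<le> j \<and> m dvd \<mu> i - j}"
    using leg_eq_0_iff[OF \<mu>(1)] Suc_arm by (auto simp: diagram_def)
  have "\<dots> = f ` I"
  proof (intro equalityI subsetI)
    fix v assume "v \<in> {(i, j). j < \<mu> i \<and> \<mu> (Suc i) \<le> j \<and> m dvd \<mu> i - j}"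
    then obtain i j where v: "v = (i, j)" and ij: "j < \<mu> i" "\<mu> (Suc i) \<le> j" "m dvd \<mu> i - j" by auto
    from ij(3) obtain s where "\<mu> i - j = m * s" by (auto simp: dvd_def)
    with ij(1) have s: "\<mu> i = j + m * s" by simp
    have "s \<noteq> 0" using s ij(1) by (cases s) auto
    have "m * s + \<mu> (Suc i) \<le> \<mu> i" using ij(2) s by simp
    \<comment> \<open>Restrictedness enters here: the difference of the parts of
      \<open>\<nu>\<close> is below \<open>m\<close> and cannot add a further multiple of
      \<open>m\<close>.\<close>
    then have "m * s + m * \<rho> (Suc i) < m + m * \<rho> i"
      using \<nu>(2)[of i] by (simp add: \<mu>(2))
    then have "m * (s + \<rho> (Suc i)) < m * (1 + \<rho> i)" by (simp add: distrib_left)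
    then have "s + \<rho> (Suc i) < 1 + \<rho> i" by (simp only: mult_less_cancel1)
    then have le: "s + \<rho> (Suc i) \<le> \<rho> i" by simp
    then obtain u where u: "\<rho> i = s + u" using le_Suc_ex[of s "\<rho> i"] by auto
    have "j = \<nu> i + m * u" using s by (simp add: \<mu>(2) u distrib_left)
    moreover have "i < N" using N[of i] u \<open>s \<noteq> 0\<close> by (cases "i < N") auto
    ultimately have "v = f (i, u)" "(i, u) \<in> I" using u le \<open>s \<noteq> 0\<close> by (auto simp: v f_def I_def)
    then show "v \<in> f ` I" by blast
  next
    fix v assume "v \<in> f ` I"
    then obtain p where p: "v = f p" "p \<in> I" by blast
    obtain i u where "p = (i, u)" by (cases p)
    with p have v: "v = (i, \<nu> i + m * u)" and u: "\<rho> (Suc i) \<le> u" "u < \<rho> i"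
      by (auto simp: f_def I_def)
    obtain s where s: "\<rho> i = u + s" "s \<noteq> 0" using u(2) by (metis less_imp_add_positive less_irrefl)
    have "\<nu> (Suc i) \<le> \<nu> i" using \<nu>(1) by (simp add: partition_antimono)
    then have "\<mu> (Suc i) \<le> \<nu> i + m * u"
      unfolding \<mu>(2) using u(1) by (intro add_mono mult_left_mono) auto
    moreover have "\<mu> i = (\<nu> i + m * u) + m * s" by (simp add: \<mu>(2) s(1) distrib_left)
    ultimately show "v \<in> {(i, j). j < \<mu> i \<and> \<mu> (Suc i) \<le> j \<and> m dvd \<mu> i - j}"
      using m s(2) by (simp add: v)
  qed
  moreover have "inj_on f I" using m by (auto simp: inj_on_def f_def)
  ultimately have "h0 m \<mu> = card I" unfolding h0_def H by (simp add: card_image)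
  also have "\<dots> = (\<Sum>i<N. \<rho> i - \<rho> (Suc i))" by (simp add: I_def)
  finally have "h0 m \<mu> = (\<Sum>i<N. \<rho> i - \<rho> (Suc i))" .
  moreover have "(\<Sum>i<n. \<rho> i - \<rho> (Suc i)) + \<rho> n = \<rho> 0" for n
  proof (induction n)
    case (Suc n)
    then show ?case using partition_antimono[OF assms(2), of n "Suc n"] by simp
  qed simp
  from this[of N] have "(\<Sum>i<N. \<rho> i - \<rho> (Suc i)) = \<rho> 0" by (simp add: N)
  ultimately show ?thesis by (simp add: \<mu>_def)
qed

section \<open>The two generating functions of the partitions with a given core\<close>

lemma gf_partitions_with_core:
  assumes "is_core m \<kappa>" "0 < m"
  shows "gf (partitions_with_core m \<kappa>) psize (\<lambda>_. 1 :: 'a::comm_ring_1)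
    = fps_X ^ psize \<kappa> * gf (Collect is_partition) (\<lambda>\<rho>. m * psize \<rho>) (\<lambda>_. 1) ^ m"
proof -
  let ?w = "\<lambda>f. \<Sum>r<m. m * psize (f r)"
  have "gf (partitions_with_core m \<kappa>) psize (\<lambda>_. 1 :: 'a)
      = gf (PiE {..<m} (\<lambda>_. Collect is_partition)) (\<lambda>f. psize \<kappa> + ?w f) (\<lambda>_. 1 * 1)"
    by (rule gf_bij[OF bij_betw_quotient[OF assms]])
      (simp_all add: psize_quotient[OF assms] sum_distrib_left)
  also have "\<dots> = fps_X ^ psize \<kappa> * gf (PiE {..<m} (\<lambda>_. Collect is_partition)) ?w (\<lambda>_. 1)"
    by (subst gf_shift) simp
  also have "\<dots> = fps_X ^ psize \<kappa> * gf (Collect is_partition) (\<lambda>\<rho>. m * psize \<rho>) (\<lambda>_. 1) ^ m"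
    using gf_PiE[OF graded_scaled_partitions[OF assms(2)], of m, where 'c = 'a] by simp
  finally show ?thesis .
qed

lemma graded_partitions_with_core: "graded (partitions_with_core m \<kappa>) psize"
  by (rule graded_subset[OF graded_partitions]) (auto simp: partitions_with_core_def)

text \<open>In \<open>\<mu> = \<nu> + m * \<rho>\<close> the core constrains only
  \<open>\<nu>\<close> and \<open>h0\<close> sees only \<open>\<rho>\<close>, so the sum factors. At
  \<open>t = 1\<close> this is a second count of the partitions with core
  \<open>\<kappa>\<close>.\<close>

lemma gf_partitions_with_core_h0:
  fixes t :: "'a::comm_ring_1"
  assumes "is_core m \<kappa>" "0 < m"
  shows "gf (partitions_with_core m \<kappa>) psize (\<lambda>\<mu>. t ^ h0 m \<mu>)
    = gf (partitions_with_core m \<kappa> \<inter> restricted_partitions m) psize (\<lambda>_. 1)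
      * gf (Collect is_partition) (\<lambda>\<rho>. m * psize \<rho>) (\<lambda>\<rho>. t ^ \<rho> 0)"
proof -
  let ?R = "partitions_with_core m \<kappa> \<inter> restricted_partitions m"
  have "gf ?R psize (\<lambda>_. 1) * gf (Collect is_partition) (\<lambda>\<rho>. m * psize \<rho>) (\<lambda>\<rho>. t ^ \<rho> 0)
      = gf (?R \<times> Collect is_partition) (\<lambda>(\<nu>, \<rho>). psize \<nu> + m * psize \<rho>) (\<lambda>(\<nu>, \<rho>). 1 * t ^ \<rho> 0)"
    by (rule gf_Times[symmetric])
      (rule graded_subset[OF graded_partitions_with_core Int_lower1] graded_scaled_partitions[OF assms(2)])+
  also have "\<dots> = gf (partitions_with_core m \<kappa>) psize (\<lambda>\<mu>. t ^ h0 m \<mu>)"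
    by (rule gf_bij[OF bij_betw_add_scaled[OF assms]])
      (auto simp: add_scaled_partition(2) h0_add_scaled restricted_partitions_def)
  finally show ?thesis ..
qed

text \<open>Comparing the quotient count with the factorisation at \<open>t = 1\<close> and
  cancelling one factor \<open>G\<close>.\<close>

lemma gf_restricted_partitions_with_core:
  assumes "is_core m \<kappa>" "0 < m"
  shows "gf (partitions_with_core m \<kappa> \<inter> restricted_partitions m) psize (\<lambda>_. 1 :: 'a::idom)
    = fps_X ^ psize \<kappa> * gf (Collect is_partition) (\<lambda>\<rho>. m * psize \<rho>) (\<lambda>_. 1) ^ (m - 1)"
proof -
  define G where "G = gf (Collect is_partition) (\<lambda>\<rho>. m * psize \<rho>) (\<lambda>_. 1 :: 'a)"
  let ?R = "partitions_with_core m \<kappa> \<inter> restricted_partitions m"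
  \<comment> \<open>In degree 0 the product is empty, so \<open>G\<close> has constant term 1 and
    may be cancelled.\<close>
  have "eq_upto 0 G 1" using gf_partitions[OF assms(2), of 0 "1 :: 'a"] by (simp add: G_def)
  then have "G \<noteq> 0" by (auto simp: eq_upto_def)
  have "gf ?R psize (\<lambda>_. 1) * G = fps_X ^ psize \<kappa> * G ^ m"
    using gf_partitions_with_core_h0[OF assms, of "1 :: 'a"] gf_partitions_with_core[OF assms, where 'a = 'a]
    by (simp add: G_def)
  also have "\<dots> = fps_X ^ psize \<kappa> * G ^ (m - 1) * G"
    using assms(2) by (cases m) (simp_all add: mult.assoc mult.commute[of G])
  finally show ?thesis using \<open>G \<noteq> 0\<close> by (simp add: G_def)
qed

text \<open>The formulas are multiplied out so that they can be checked in each degree with finite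
  products, and over any domain, since both \<open>rat\<close> and \<open>rat fps\<close> occur as
  coefficients.\<close>

lemma core_generating_function:
  fixes t :: "'a::idom"
  assumes "is_core m \<kappa>" "0 < m"
  defines "P \<equiv> \<Prod>i. (1 - fps_X ^ (m * (i + 1))) ^ (m - 1) :: 'a fps"
    and "Q \<equiv> \<Prod>i. (1 - fps_X ^ (m * (i + 1))) ^ (m - 1) * (1 - fps_const t * fps_X ^ (m * (i + 1)))"
  shows "P $ 0 = 1" "Q $ 0 = 1"
    "gf (partitions_with_core m \<kappa> \<inter> restricted_partitions m) psize (\<lambda>_. 1) * P = fps_X ^ psize \<kappa>"
    "gf (partitions_with_core m \<kappa>) psize (\<lambda>\<mu>. t ^ h0 m \<mu>) * Q = fps_X ^ psize \<kappa>"
proof -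
  define G where "G s = gf (Collect is_partition) (\<lambda>\<rho>. m * psize \<rho>) (\<lambda>\<rho>. s ^ \<rho> 0)" for s :: 'a
  define D where "D s i = 1 - fps_const s * fps_X ^ (m * (i + 1))" for s :: 'a and i
  have D: "eq_upto i (D s i) 1" for s i
  proof -
    \<comment> \<open>So the factor of index \<open>i\<close> is 1 modulo q^(i+1), as
      \<open>prodinf_fps_eq_upto\<close> demands.\<close>
    have "i < m * (i + 1)" using assms(2) by (cases m) auto
    then show ?thesis by (auto simp: eq_upto_def D_def mult.assoc fps_X_power_nth)
  qed
  have P: "P = (\<Prod>i. D 1 i ^ (m - 1))" and Q: "Q = (\<Prod>i. D 1 i ^ (m - 1) * D t i)"
    by (simp_all add: P_def Q_def D_def)
  have D_pow: "eq_upto i (D 1 i ^ (m - 1)) 1" for i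
    using eq_upto_power[OF D] by fastforce
  have P_upto: "eq_upto n P (\<Prod>i<n. D 1 i ^ (m - 1))" for n
    unfolding P by (rule prodinf_fps_eq_upto[OF D_pow])
  have "eq_upto i (D 1 i ^ (m - 1) * D t i) 1" for i
    using eq_upto_mult[OF D_pow D] by fastforce
  then have Q_upto: "eq_upto n Q (\<Prod>i<n. D 1 i ^ (m - 1) * D t i)" for n
    unfolding Q by (rule prodinf_fps_eq_upto)
  show "P $ 0 = 1" "Q $ 0 = 1" using P_upto[of 0] Q_upto[of 0] by (simp_all add: eq_upto_def)
  have GD: "eq_upto n (G s * (\<Prod>i<n. D s i)) 1" for s n
    unfolding G_def D_def by (rule gf_partitions[OF assms(2)])
  let ?R = "gf (partitions_with_core m \<kappa> \<inter> restricted_partitions m) psize (\<lambda>_. 1 :: 'a)"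
  have R: "?R = fps_X ^ psize \<kappa> * G 1 ^ (m - 1)"
    using gf_restricted_partitions_with_core[OF assms(1,2), where 'a = 'a] by (simp add: G_def)
  have GD_pow: "eq_upto n (G 1 ^ (m - 1) * (\<Prod>i<n. D 1 i ^ (m - 1))) 1" for n
    using eq_upto_power[OF GD[of n 1], of "m - 1"] by (simp add: power_mult_distrib prod_power_distrib)
  show "?R * P = fps_X ^ psize \<kappa>"
  proof (rule eq_upto_imp_eq)
    fix n
    have "eq_upto n (?R * P) (fps_X ^ psize \<kappa> * G 1 ^ (m - 1) * (\<Prod>i<n. D 1 i ^ (m - 1)))"
      unfolding R by (rule eq_upto_mult[OF eq_upto_refl P_upto])
    moreover have "eq_upto n (fps_X ^ psize \<kappa> * G 1 ^ (m - 1) * (\<Prod>i<n. D 1 i ^ (m - 1))) (fps_X ^ psize \<kappa> * 1)"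
      unfolding mult.assoc by (rule eq_upto_mult[OF eq_upto_refl GD_pow])
    ultimately show "eq_upto n (?R * P) (fps_X ^ psize \<kappa>)" by (simp add: eq_upto_def)
  qed
  let ?F = "gf (partitions_with_core m \<kappa>) psize (\<lambda>\<mu>. t ^ h0 m \<mu>)"
  have F: "?F = fps_X ^ psize \<kappa> * G 1 ^ (m - 1) * G t"
    using gf_partitions_with_core_h0[OF assms(1,2), of t] by (simp add: R G_def)
  show "?F * Q = fps_X ^ psize \<kappa>"
  proof (rule eq_upto_imp_eq)
    fix n
    let ?A = "\<Prod>i<n. D 1 i ^ (m - 1)" and ?B = "\<Prod>i<n. D t i"
    have FQ: "eq_upto n (?F * Q) (?F * (?A * ?B))"
      using eq_upto_mult[OF eq_upto_refl Q_upto[of n]] by (simp add: prod.distrib)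
    have eq: "?F * (?A * ?B) = fps_X ^ psize \<kappa> * ((G 1 ^ (m - 1) * ?A) * (G t * ?B))"
      unfolding F by (simp only: mult.assoc mult.left_commute)
    have "eq_upto n (fps_X ^ psize \<kappa> * ((G 1 ^ (m - 1) * ?A) * (G t * ?B))) (fps_X ^ psize \<kappa> * (1 * 1))"
      by (intro eq_upto_mult eq_upto_refl GD_pow GD)
    from eq_upto_trans[OF FQ[unfolded eq] this]
    show "eq_upto n (?F * Q) (fps_X ^ psize \<kappa>)" by simp
  qed
qed

theorem theorem6p14:
  fixes m :: nat and core :: "nat \<Rightarrow> nat"
  assumes "m \<ge> 2" and "is_core m core"
  shows "((\<lambda>\<mu>. qvar ^ psize \<mu> :: rat fps) has_sum
            qvar ^ psize core / (\<Prod>i. (1 - qvar ^ (m * (i + 1))) ^ (m - 1)))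
           (partitions_with_core m core \<inter> restricted_partitions m)
       \<and> ((\<lambda>\<mu>. tvar ^ h0 m \<mu> * qvar ^ psize \<mu> :: rat fps fps) has_sum
            qvar ^ psize core /
              (\<Prod>i. (1 - qvar ^ (m * (i + 1))) ^ (m - 1) * (1 - tvar * qvar ^ (m * (i + 1)))))
           (partitions_with_core m core)"
proof -
  have m: "0 < m" using assms(1) by simp
  \<comment> \<open>Used at two coefficient rings: \<open>rat\<close> for the first sum, and
    \<open>rat fps\<close> with t as its variable for the second.\<close>
  note gen = core_generating_function[OF assms(2) m]
  have "((\<lambda>\<mu>. qvar ^ psize \<mu> :: rat fps) has_sum
      gf (partitions_with_core m core \<inter> restricted_partitions m) psize (\<lambda>_. 1))
      (partitions_with_core m core \<inter> restricted_partitions m)"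
    using has_sum_gf[OF graded_subset[OF graded_partitions_with_core Int_lower1], where g = "\<lambda>_. 1 :: rat"]
    by simp
  moreover have "((\<lambda>\<mu>. tvar ^ h0 m \<mu> * qvar ^ psize \<mu>) has_sum
      gf (partitions_with_core m core) psize (\<lambda>\<mu>. fps_X ^ h0 m \<mu>)) (partitions_with_core m core)"
    using has_sum_gf[OF graded_partitions_with_core, where g = "\<lambda>\<mu>. fps_X ^ h0 m \<mu> :: rat fps"]
    by (simp add: fps_const_power)
  ultimately show ?thesis
    by (simp only: fps_divide_eqI[OF inverse_1 gen(1,3)] fps_divide_eqI[OF fps_inverse_one gen(2,4)])
qed

end
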